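(* Let $-1<q\le1$, let $\rho_{12},\rho_{13},\rho_{23}\in(-1,1)$ satisfy $1+2\rho_{12}\rho_{13}\rho_{23}-\rho_{12}^2-\rho_{13}^2-\rho_{23}^2\ge0$, and write $\rho_{ba}=\rho_{ab}$. Let $x_1,x_2,x_3\in S(q)$. Then for every permutation $(a,b,c)$ of $(1,2,3)$: i) $$f_{3D}(x_1,x_2,x_3|\rho_{12},\rho_{13},\rho_{23},q)=f_{CN}(x_c|x_a,\rho_{ac},q)f_N(x_a|q)f_N(x_b|q)\sum_{s\ge0}\frac{1}{[s]_q!}H_s(x_b|q)\,C_s(x_a,x_c|\rho_{ab},\rho_{bc},\rho_{ac},q);$$ ii) $$f_{3D}(x_1,x_2,x_3|\rho_{12},\rho_{13},\rho_{23},q)=f_{CN}(x_a|x_c,\rho_{ac},q)f_{CN}(x_c|x_b,\rho_{bc},q)f_N(x_b|q)\sum_{s=0}^\infty\frac{\rho_{ab}^s(\rho_{ac}\rho_{bc}/\rho_{ab})_s}{[s]_q!\,(\rho_{ac}^2,\rho_{bc}^2)_s}P_s(x_a|x_c,\rho_{ac},q)P_s(x_b|x_c,\rho_{bc},q).$$ (The case $(a,b,c)=(1,2,3)$ is the basic one.)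
   Context: Notation, for $-1<q\le1$: $[0]_q=0$, $[n]_q=1+q+\dots+q^{n-1}$, $[n]_q!=\prod_{i=1}^n[i]_q$, $[0]_q!=1$; $\binom{n}{k}_q=\frac{[n]_q!}{[k]_q![n-k]_q!}$ for $0\le k\le n$; $(a)_n=\prod_{i=0}^{n-1}(1-aq^i)$, $(a)_0=1$, $(a,b)_n=(a)_n(b)_n$, and, for $|q|<1$, $(a)_\infty=\prod_{i\ge0}(1-aq^i)$. The expression $c^s(a/c)_s$ is always read as $\prod_{i=0}^{s-1}(c-aq^i)$ (so it makes sense for $c=0$). $S(q)=[-2/\sqrt{1-q},2/\sqrt{1-q}]$ for $|q|<1$ and $S(1)=\mathbb R$. $q$-Hermite polynomials: $H_{-1}=0$, $H_0=1$, $H_{n+1}(x|q)=xH_n(x|q)-[n]_qH_{n-1}(x|q)$. Al-Salam–Chihara polynomials: $P_{-1}=0$, $P_0=1$, $P_{n+1}(x|y,\rho,q)=(x-\rho yq^n)P_n(x|y,\rho,q)-(1-\rho^2q^{n-1})[n]_qP_{n-1}(x|y,\rho,q)$, $n\ge0$. Densities, for $|q|<1$, $x,y\in S(q)$, $|\rho|<1$: $$f_N(x|q)=\frac{(q)_\infty\sqrt{1-q}}{2\pi}\sqrt{4-(1-q)x^2}\prod_{k=1}^\infty\big((1+q^k)^2-(1-q)x^2q^k\big),\qquad f_{CN}(x|y,\rho,q)=f_N(x|q)\,(\rho^2)_\infty\prod_{k=0}^\infty\frac1{v_0(x,y|\rho q^k,q)},$$ where $v_0(x,y|\rho,q)=(1-\rho^2)^2-(1-q)\rho(1+\rho^2)xy+(1-q)\rho^2(x^2+y^2)$.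 For $q=1$: $f_N(x|1)=\frac1{\sqrt{2\pi}}e^{-x^2/2}$, $f_{CN}(x|y,\rho,1)=\frac1{\sqrt{2\pi(1-\rho^2)}}\exp\left(-\frac{(x-\rho y)^2}{2(1-\rho^2)}\right)$. $$f_{3D}(x_1,x_2,x_3|\rho_{12},\rho_{13},\rho_{23},q)=\prod_{i=1}^3f_N(x_i|q)\sum_{i,j,k\ge0}\frac{\rho_{12}^j\rho_{23}^k\rho_{13}^i}{[i]_q![j]_q![k]_q!}H_{i+j}(x_1|q)H_{j+k}(x_2|q)H_{i+k}(x_3|q)$$ (the series is absolutely convergent for $|q|<1$; for $q=1$ it is the classical Kibble–Slepian expansion, and $f_{3D}$ is the density of the centered Gaussian distribution with unit variances and correlations $\rho_{12},\rho_{13},\rho_{23}$). For $m,k\ge0$ put $\gamma_{m,k}(x,y|\rho,q)=\sum_{i\ge0}\frac{\rho^i}{[i]_q!}H_{i+m}(x|q)H_{i+k}(y|q)$ and $Q_{m,k}(x,y|\rho,q)=\gamma_{m,k}(x,y|\rho,q)/\gamma_{0,0}(x,y|\rho,q)$ (here $\gamma_{0,0}>0$), and $$C_n(x,y|\rho_1,\rho_2,\rho_3,q)=\sum_{i=0}^n\binom{n}{i}_q\rho_1^{n-i}\rho_2^iQ_{n-i,i}(x,y|\rho_3,q).$$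
   Formalization: For q = 1 the condition 1+2ρ12ρ13ρ23−ρ12²−ρ13²−ρ23² ≥ 0 is taken strictly (> 0), since with equality (e.g. all ρ = −1/2) the Gaussian law is singular and has no density, so f_3D is undefined. *)

theory Defs
  imports "HOL-Analysis.Analysis" "HOL-Combinatorics.Combinatorics"
begin

definition qint :: "real \<Rightarrow> nat \<Rightarrow> real" where
  "qint q n = (\<Sum>i<n. q ^ i)"

definition qfact :: "real \<Rightarrow> nat \<Rightarrow> real" where
  "qfact q n = (\<Prod>i=1..n. qint q i)"

text \<open>Only meaningful for \<open>k \<le> n\<close>.\<close>

definition qbinomial :: "real \<Rightarrow> nat \<Rightarrow> nat \<Rightarrow> real" where
  "qbinomial q n k = qfact q n / (qfact q k * qfact q (n - k))"

definition qpoch :: "real \<Rightarrow> real \<Rightarrow> nat \<Rightarrow> real" where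
  "qpoch q a n = (\<Prod>i<n. 1 - a * q ^ i)"

definition qpoch2 :: "real \<Rightarrow> real \<Rightarrow> real \<Rightarrow> nat \<Rightarrow> real" where
  "qpoch2 q a b n = qpoch q a n * qpoch q b n"

definition qpoch_inf :: "real \<Rightarrow> real \<Rightarrow> real" where
  "qpoch_inf q a = (\<Prod>i. 1 - a * q ^ i)"

text \<open>The expression \<open>c\<^sup>s (a/c)\<^sub>s\<close>, in the form that also covers \<open>c = 0\<close>.\<close>

definition qpoch_hom :: "real \<Rightarrow> real \<Rightarrow> real \<Rightarrow> nat \<Rightarrow> real" where
  "qpoch_hom q c a s = (\<Prod>i<s. c - a * q ^ i)"

definition S :: "real \<Rightarrow> real set" where
  "S q = (if q = 1 then UNIV else {- 2 / sqrt (1 - q) .. 2 / sqrt (1 - q)})"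

text \<open>The three-term recurrences start from the values at \<open>-1\<close> and \<open>0\<close>, namely \<open>0\<close> and \<open>1\<close>;
  the value at \<open>1\<close> is the recurrence at \<open>n = 0\<close>, whose last term vanishes.\<close>

fun qHermite :: "real \<Rightarrow> nat \<Rightarrow> real \<Rightarrow> real" where
  "qHermite q 0 x = 1"
| "qHermite q (Suc 0) x = x"
| "qHermite q (Suc (Suc n)) x =
     x * qHermite q (Suc n) x - qint q (Suc n) * qHermite q n x"

fun ASC :: "real \<Rightarrow> nat \<Rightarrow> real \<Rightarrow> real \<Rightarrow> real \<Rightarrow> real" where
  "ASC q 0 x y \<rho> = 1"
| "ASC q (Suc 0) x y \<rho> = x - \<rho> * y"
| "ASC q (Suc (Suc n)) x y \<rho> =
     (x - \<rho> * y * q ^ Suc n) * ASC q (Suc n) x y \<rho>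
       - (1 - \<rho>\<^sup>2 * q ^ n) * qint q (Suc n) * ASC q n x y \<rho>"

definition f_N :: "real \<Rightarrow> real \<Rightarrow> real" where
  "f_N q x =
    (if q = 1 then exp (- x\<^sup>2 / 2) / sqrt (2 * pi)
     else qpoch_inf q q * sqrt (1 - q) / (2 * pi) * sqrt (4 - (1 - q) * x\<^sup>2)
       * (\<Prod>k. (1 + q ^ Suc k)\<^sup>2 - (1 - q) * x\<^sup>2 * q ^ Suc k))"

definition v0 :: "real \<Rightarrow> real \<Rightarrow> real \<Rightarrow> real \<Rightarrow> real" where
  "v0 q x y \<rho> =
     (1 - \<rho>\<^sup>2)\<^sup>2 - (1 - q) * \<rho> * (1 + \<rho>\<^sup>2) * x * y + (1 - q) * \<rho>\<^sup>2 * (x\<^sup>2 + y\<^sup>2)"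

definition f_CN :: "real \<Rightarrow> real \<Rightarrow> real \<Rightarrow> real \<Rightarrow> real" where
  "f_CN q x y \<rho> =
    (if q = 1 then exp (- (x - \<rho> * y)\<^sup>2 / (2 * (1 - \<rho>\<^sup>2))) / sqrt (2 * pi * (1 - \<rho>\<^sup>2))
     else f_N q x * qpoch_inf q (\<rho>\<^sup>2) * (\<Prod>k. 1 / v0 q x y (\<rho> * q ^ k)))"

text \<open>Density of the centered Gaussian distribution with (positive definite) covariance
  matrix \<open>R\<close>.\<close>

definition gaussian_density :: "real^'n^'n \<Rightarrow> real^'n \<Rightarrow> real" where
  "gaussian_density R x =
     exp (- (x \<bullet> (matrix_inv R *v x)) / 2) / sqrt ((2 * pi) ^ CARD('n) * det R)"

definition corr_matrix :: "real \<Rightarrow> real \<Rightarrow> real \<Rightarrow> real^3^3" where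
  "corr_matrix \<rho>12 \<rho>13 \<rho>23 =
     vector [vector [1, \<rho>12, \<rho>13], vector [\<rho>12, 1, \<rho>23], vector [\<rho>13, \<rho>23, 1]]"

text \<open>For \<open>q = 1\<close> the triple (Kibble--Slepian) series does not converge for every positive
  definite correlation matrix, so there the function is given by the Gaussian density which
  that series expands.\<close>

definition f_3D :: "real \<Rightarrow> real \<Rightarrow> real \<Rightarrow> real \<Rightarrow> real \<Rightarrow> real \<Rightarrow> real \<Rightarrow> real" where
  "f_3D q x1 x2 x3 \<rho>12 \<rho>13 \<rho>23 =
    (if q = 1 then gaussian_density (corr_matrix \<rho>12 \<rho>13 \<rho>23) (vector [x1, x2, x3])
     else f_N q x1 * f_N q x2 * f_N q x3 *
       (\<Sum>\<^sub>\<infinity>(i, j, k)\<in>UNIV. \<rho>12 ^ j * \<rho>23 ^ k * \<rho>13 ^ i / (qfact q i * qfact q j * qfact q k)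
          * qHermite q (i + j) x1 * qHermite q (j + k) x2 * qHermite q (i + k) x3))"

definition gam :: "real \<Rightarrow> nat \<Rightarrow> nat \<Rightarrow> real \<Rightarrow> real \<Rightarrow> real \<Rightarrow> real" where
  "gam q m k x y \<rho> =
     (\<Sum>i. \<rho> ^ i / qfact q i * qHermite q (i + m) x * qHermite q (i + k) y)"

definition Q :: "real \<Rightarrow> nat \<Rightarrow> nat \<Rightarrow> real \<Rightarrow> real \<Rightarrow> real \<Rightarrow> real" where
  "Q q m k x y \<rho> = gam q m k x y \<rho> / gam q 0 0 x y \<rho>"

definition C :: "real \<Rightarrow> nat \<Rightarrow> real \<Rightarrow> real \<Rightarrow> real \<Rightarrow> real \<Rightarrow> real \<Rightarrow> real" where
  "C q n x y \<rho>1 \<rho>2 \<rho>3 =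
     (\<Sum>i=0..n. qbinomial q n i * \<rho>1 ^ (n - i) * \<rho>2 ^ i * Q q (n - i) i x y \<rho>3)"

end

theory Submission
  imports Defs
begin

text \<open>
  Write \<open>\<gamma>\<^sub>m\<^sub>,\<^sub>k(x, y|\<rho>)\<close> for \<open>gam q m k x y \<rho>\<close>.  Everything rests on the three-term recurrence of the
  q-Hermite polynomials \<open>H\<^sub>n\<close>.  Applied under the sum in either variable, with
  \<open>[i + m] = [m] + q\<^sup>m [i]\<close>, it gives two linear relations between neighbouring \<open>\<gamma>\<^sub>m\<^sub>,\<^sub>k\<close>
  (\<open>gam_Suc_left\<close>, \<open>gam_Suc_right\<close>).  Eliminating the second index between them leaves exactly the
  recurrence of the Al-Salam--Chihara polynomials, so
  \<open>\<gamma>\<^sub>m\<^sub>,\<^sub>0 = P\<^sub>m(x|y, \<rho>) / (\<rho>\<^sup>2)\<^sub>m \<cdot> \<gamma>\<^sub>0\<^sub>,\<^sub>0\<close> (\<open>gam_ASC\<close>), and also expresses \<open>\<gamma>\<^sub>1\<^sub>,\<^sub>1\<close>, the q-derivative of \<open>\<gamma>\<^sub>0\<^sub>,\<^sub>0\<close> in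
  \<open>\<rho>\<close>, as a rational multiple of \<open>\<gamma>\<^sub>0\<^sub>,\<^sub>0\<close> (\<open>gam_1_1\<close>).

  The last relation is a first-order q-difference equation in \<open>\<rho>\<close> when \<open>|q| < 1\<close> and a first-order
  differential equation when \<open>q = 1\<close>.  With the initial value \<open>\<gamma>\<^sub>0\<^sub>,\<^sub>0(x, y|0) = 1\<close> its solution is the
  Poisson--Mehler kernel, and so \<open>f\<^sub>C\<^sub>N(x|y, \<rho>) = f\<^sub>N(x) \<gamma>\<^sub>0\<^sub>,\<^sub>0(x, y|\<rho>)\<close> for every \<open>q\<close>
  (\<open>f_CN_eq_gam\<close>).  All densities in the theorem are now expressed through \<open>f\<^sub>N\<close> and \<open>\<gamma>\<^sub>0\<^sub>,\<^sub>0\<close>.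

  For \<open>|q| < 1\<close>, expansion (i) is the triple series summed first over the exponent of \<open>\<rho>\<^sub>1\<^sub>3\<close> and then
  along the diagonals of the other two indices (\<open>triple_sums_C\<close>).  For (ii), one first writes
  \<open>H\<^sub>i\<^sub>+\<^sub>k(x\<^sub>3)\<close> as a combination of products \<open>H\<^sub>i\<^sub>-\<^sub>l(x\<^sub>3) H\<^sub>k\<^sub>-\<^sub>l(x\<^sub>3)\<close> (\<open>inverse_linearization\<close>).  The resulting
  quadruple series splits, for fixed \<open>l\<close> and \<open>j\<close>, into \<open>\<gamma>\<^sub>l\<^sub>+\<^sub>j\<^sub>,\<^sub>0(x\<^sub>1, x\<^sub>3) \<gamma>\<^sub>l\<^sub>+\<^sub>j\<^sub>,\<^sub>0(x\<^sub>2, x\<^sub>3)\<close>, and on the diagonal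
  \<open>l + j = s\<close> the coefficients add up by the q-binomial theorem to
  \<open>\<Prod>\<^sub>i\<^sub><\<^sub>s (\<rho>\<^sub>1\<^sub>2 - \<rho>\<^sub>1\<^sub>3 \<rho>\<^sub>2\<^sub>3 q\<^sup>i)\<close> (\<open>triple_sums_ASC\<close>).  Absolute convergence comes from
  \<open>|H\<^sub>n(x)|\<close> and \<open>1 / [n]!\<close> growing at most like \<open>u\<^sup>n\<close> and \<open>v\<^sup>n\<close>, where \<open>u\<^sup>2 v\<close> can be taken as close to
  \<open>1\<close> as desired (\<open>growth_rates\<close>).

  For \<open>q = 1\<close> the triple series need not converge, and both expansions are instances of Mehler's
  formula.  In (i) the \<open>C\<^sub>n\<close> satisfy the recurrence of scaled Hermite polynomials with the
  conditional mean of \<open>X\<^sub>2\<close> given \<open>X\<^sub>1, X\<^sub>3\<close> as argument, and the squared correlation in Mehler's formula is the squared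
  multiple correlation coefficient.  In (ii) the Al-Salam--Chihara polynomials are scaled Hermite polynomials of
  the standardized residuals of \<open>X\<^sub>1\<close> and \<open>X\<^sub>2\<close> given \<open>X\<^sub>3\<close>, and the correlation is the partial
  correlation.  What remains is to compare quadratic forms.

  Finally \<open>f\<^sub>3\<^sub>D\<close> is invariant under renumbering of the variables, so the case
  \<open>(a, b, c) = (1, 2, 3)\<close> suffices.
\<close>


section \<open>q-integers, q-factorials and the recurrences\<close>

lemma qint_0 [simp]: "qint q 0 = 0" by (simp add: qint_def)

lemma qint_Suc: "qint q (Suc n) = qint q n + q ^ n" by (simp add: qint_def)

lemma qint_one [simp]: "qint 1 n = real n" by (simp add: qint_def)

lemma qint_add: "qint q (m + n) = qint q m + q ^ m * qint q n"
  by (induction n) (simp_all add: qint_Suc algebra_simps power_add)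

lemma qint_times: "(1 - q) * qint q n = 1 - q ^ n"
proof (induction n)
  case (Suc n)
  have "(1 - q) * qint q (Suc n) = (1 - q) * qint q n + (1 - q) * q ^ n"
    by (simp add: qint_Suc distrib_left)
  also have "\<dots> = 1 - q ^ n + (1 - q) * q ^ n" by (simp only: Suc)
  finally show ?case by (simp add: left_diff_distrib)
qed simp

lemma qint_pos:
  assumes "-1 < q" "q \<le> 1" "n > 0"
  shows "qint q n > 0"
proof (cases "q = 1")
  case False
  with assms have "\<bar>q\<bar> < 1" by auto
  then have "\<bar>q ^ n\<bar> < 1"
    using assms(3) by (simp add: power_abs power_less_one_iff)
  then have "(1 - q) * qint q n > 0" by (simp add: qint_times abs_less_iff)
  then show ?thesis using assms False by (simp add: zero_less_mult_iff)
qed (use assms in simp)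

lemma qfact_0 [simp]: "qfact q 0 = 1" by (simp add: qfact_def)

lemma qfact_Suc: "qfact q (Suc n) = qint q (Suc n) * qfact q n"
  by (simp add: qfact_def)

lemma qfact_one: "qfact 1 n = fact n"
  by (induction n) (simp_all add: qfact_Suc)

lemma qfact_pos: "-1 < q \<Longrightarrow> q \<le> 1 \<Longrightarrow> qfact q n > 0"
  by (induction n) (simp_all add: qfact_Suc qint_pos)

text \<open>The recurrences hold from \<open>n = 0\<close> on: there the truncated index \<open>n - 1\<close> is multiplied by
  \<open>[0] = 0\<close>.\<close>

lemma qHermite_Suc:
  "qHermite q (Suc n) x = x * qHermite q n x - qint q n * qHermite q (n - 1) x"
  by (cases n) simp_all

lemma ASC_Suc:
  "ASC q (Suc n) x y \<rho> = (x - \<rho> * y * q ^ n) * ASC q n x y \<rho>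
     - (1 - \<rho>\<^sup>2 * q ^ (n - 1)) * qint q n * ASC q (n - 1) x y \<rho>"
  by (cases n) simp_all

section \<open>Growth of the q-factorials and of the q-Hermite polynomials\<close>

lemma geometric_bound:
  fixes a :: "nat \<Rightarrow> real"
  assumes r: "r > 0" and step: "eventually (\<lambda>n. a (Suc n) \<le> r * a n) sequentially"
  obtains K where "K > 0" "\<And>n. a n \<le> K * r ^ n"
proof -
  obtain N where N: "\<And>n. n \<ge> N \<Longrightarrow> a (Suc n) \<le> r * a n"
    using step by (auto simp: eventually_sequentially)
  define K where "K = 1 + (\<Sum>i\<le>N. \<bar>a i\<bar> / r ^ i)"
  have init: "a n \<le> K * r ^ n" if "n \<le> N" for n
  proof -
    have "\<bar>a n\<bar> / r ^ n \<le> (\<Sum>i\<le>N. \<bar>a i\<bar> / r ^ i)"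
      using that r by (intro member_le_sum) auto
    then have "\<bar>a n\<bar> / r ^ n \<le> K" by (simp add: K_def)
    then show ?thesis using r by (simp add: pos_divide_le_eq)
  qed
  have "a n \<le> K * r ^ n" for n
  proof (induction n)
    case (Suc n)
    show ?case
    proof (cases "n \<ge> N")
      case True
      have "a (Suc n) \<le> r * a n" by (rule N[OF True])
      also have "\<dots> \<le> r * (K * r ^ n)" using Suc r by (intro mult_left_mono) auto
      finally show ?thesis by (simp add: mult_ac)
    qed (use init[of "Suc n"] in simp)
  qed (use init[of 0] in simp)
  moreover have "K > 0" unfolding K_def
    using r by (intro add_pos_nonneg sum_nonneg) auto
  ultimately show ?thesis by (rule that[rotated])
qed

lemma inverse_qfact_bound:
  assumes q: "\<bar>q\<bar> < 1" and r: "r > 1"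
  obtains K where "K > 0" "\<And>n. 1 / qfact q n \<le> K * (r * (1 - q)) ^ n"
proof -
  have "(\<lambda>n. q ^ Suc n) \<longlonglongrightarrow> 0"
    using q by (intro LIMSEQ_Suc LIMSEQ_abs_realpow_zero2)
  then have "eventually (\<lambda>n. q ^ Suc n < 1 - 1 / r) sequentially"
    using r by (intro order_tendstoD) auto
  then have "eventually (\<lambda>n. 1 / qfact q (Suc n) \<le> r * (1 - q) * (1 / qfact q n)) sequentially"
  proof eventually_elim
    case (elim n)
    have pos: "qfact q n > 0" "qint q (Suc n) > 0" using q by (auto intro!: qfact_pos qint_pos)
    have "r * (1 - q) * qint q (Suc n) = r * (1 - q ^ Suc n)"
      using qint_times[of q "Suc n"] by (simp add: mult.assoc)
    also have "\<dots> \<ge> r * (1 / r)" using elim r by (intro mult_left_mono) auto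
    finally have "1 \<le> r * (1 - q) * qint q (Suc n)" using r by simp
    then show ?case using pos by (simp add: qfact_Suc field_simps)
  qed
  moreover have "r * (1 - q) > 0" using q r by auto
  ultimately show ?thesis using geometric_bound[of "r * (1 - q)" "\<lambda>n. 1 / qfact q n"] that by blast
qed

text \<open>With \<open>h\<^sub>n = (1 - q)\<^bsup>n/2\<^esup> H\<^sub>n(x)\<close> and \<open>\<surd>(1 - q) x = 2 cos \<theta>\<close> the recurrence becomes
  \<open>h\<^sub>n\<^sub>+\<^sub>2 = 2 cos \<theta> h\<^sub>n\<^sub>+\<^sub>1 - (1 - q\<^bsup>n+1\<^esup>) h\<^sub>n\<close>, a perturbation of the Chebyshev recurrence with
  characteristic roots \<open>w = e\<^bsup>i\<theta>\<^esup>\<close> and its conjugate on the unit circle.  So \<open>h\<^sub>n\<close> has no exponential growth; this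
  is where \<open>x \<in> S q\<close> enters.  The quantity \<open>L\<^sub>n = \<epsilon> |h\<^sub>n| + |h\<^sub>n\<^sub>+\<^sub>1 - w h\<^sub>n|\<close> absorbs the double root at
  \<open>cos \<theta> = \<plusminus>1\<close>: once \<open>|q|\<^bsup>n+1\<^esup> < \<epsilon>\<^sup>2\<close>, it grows by a factor of at most \<open>1 + \<epsilon>\<close> per step.\<close>

lemma qHermite_bound:
  assumes q: "\<bar>q\<bar> < 1" and x: "x \<in> S q" and r: "r > 1"
  obtains K where "K > 0" "\<And>n. \<bar>qHermite q n x\<bar> \<le> K * (r / sqrt (1 - q)) ^ n"
proof -
  define b where "b = sqrt (1 - q)"
  have b: "b > 0" "b * b = 1 - q" using q by (auto simp: b_def)
  have "\<bar>b * x / 2\<bar> \<le> 1"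
    using x q b(1) by (auto simp: S_def b_def[symmetric] abs_le_iff field_simps split: if_splits)
  then obtain \<theta> where \<theta>: "b * x / 2 = cos \<theta>"
    by (metis abs_le_iff cos_arccos minus_le_iff)
  define w where "w = cis \<theta>"
  have w: "norm w = 1" "norm (cnj w) = 1" "cnj w * w = 1" "w + cnj w = of_real (b * x)"
    using \<theta> by (auto simp: w_def complex_eq_iff simp flip: power2_eq_square)
  define h where "h n = b ^ n * qHermite q n x" for n
  define d where "d n = of_real (h (Suc n)) - w * of_real (h n)" for n
  have h_rec: "h (Suc (Suc n)) = b * x * h (Suc n) - (1 - q ^ Suc n) * h n" for n
  proof -
    have "h (Suc (Suc n)) = b * x * h (Suc n) - (b * b) * qint q (Suc n) * h n"
      by (simp add: h_def algebra_simps)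
    then show ?thesis using b(2) qint_times[of q "Suc n"] by simp
  qed
  \<comment> \<open>up to a perturbation of relative size \<open>|q|\<^bsup>n+1\<^esup>\<close>, the defect \<open>d\<close> only rotates\<close>
  have d_rec: "d (Suc n) = cnj w * d n + of_real (q ^ Suc n * h n)" for n
  proof -
    have "d (Suc n) = (of_real (b * x) - w) * of_real (h (Suc n)) - of_real ((1 - q ^ Suc n) * h n)"
      by (simp only: d_def h_rec) (simp add: algebra_simps)
    also have "of_real (b * x) - w = cnj w" using w(4) by (metis add_diff_cancel_left')
    also have "cnj w * of_real (h (Suc n)) - of_real ((1 - q ^ Suc n) * h n) =
        cnj w * of_real (h (Suc n)) - (cnj w * w) * of_real ((1 - q ^ Suc n) * h n)"
      by (simp only: w(3) mult_1_left)
    finally show ?thesis using w(3) by (simp add: d_def algebra_simps)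
  qed
  define \<epsilon> where "\<epsilon> = r - 1"
  have \<epsilon>: "\<epsilon> > 0" using r by (simp add: \<epsilon>_def)
  define L where "L n = \<epsilon> * \<bar>h n\<bar> + norm (d n)" for n
  have "(\<lambda>n. \<bar>q\<bar> ^ Suc n) \<longlonglongrightarrow> 0"
    using q by (intro LIMSEQ_Suc LIMSEQ_abs_realpow_zero2) auto
  then have "eventually (\<lambda>n. \<bar>q\<bar> ^ Suc n < \<epsilon> * \<epsilon>) sequentially"
    using \<epsilon> by (intro order_tendstoD) auto
  then have "eventually (\<lambda>n. L (Suc n) \<le> r * L n) sequentially"
  proof eventually_elim
    case (elim n)
    have "norm (d (Suc n)) \<le> norm (d n) + \<bar>q\<bar> ^ Suc n * \<bar>h n\<bar>"
      unfolding d_rec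
      by (rule order.trans[OF norm_triangle_ineq]) (simp add: norm_mult w norm_power abs_mult power_abs del: of_real_mult)
    also have "\<bar>q\<bar> ^ Suc n * \<bar>h n\<bar> \<le> (\<epsilon> * \<epsilon>) * \<bar>h n\<bar>" using elim by (intro mult_right_mono) auto
    finally have 1: "norm (d (Suc n)) \<le> norm (d n) + (\<epsilon> * \<epsilon>) * \<bar>h n\<bar>" by simp
    have "\<bar>h (Suc n)\<bar> = norm (complex_of_real (h (Suc n)))" by simp
    also have "complex_of_real (h (Suc n)) = d n + w * of_real (h n)" by (simp add: d_def)
    also have "norm \<dots> \<le> norm (d n) + \<bar>h n\<bar>"
      by (rule order.trans[OF norm_triangle_ineq]) (simp add: norm_mult w)
    finally have "\<epsilon> * \<bar>h (Suc n)\<bar> \<le> \<epsilon> * (norm (d n) + \<bar>h n\<bar>)" using \<epsilon> by (intro mult_left_mono) auto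
    with 1 show ?case by (simp add: L_def \<epsilon>_def algebra_simps)
  qed
  then obtain K where K: "K > 0" "\<And>n. L n \<le> K * r ^ n"
    using geometric_bound[of r L] r by auto
  have "\<bar>qHermite q n x\<bar> \<le> K / \<epsilon> * (r / b) ^ n" for n
  proof -
    have "\<epsilon> * \<bar>h n\<bar> \<le> L n" by (simp add: L_def)
    then have "\<epsilon> * \<bar>h n\<bar> \<le> K * r ^ n" using K(2)[of n] by linarith
    then show ?thesis using \<epsilon> b(1) by (simp add: h_def abs_mult power_divide field_simps)
  qed
  then show ?thesis using that[of "K / \<epsilon>"] K \<epsilon> by (simp add: b_def)
qed

text \<open>After division by \<open>\<surd>(n!)\<close> the recurrence reads
  \<open>h\<^sub>n\<^sub>+\<^sub>2 = x / \<surd>(n + 2) h\<^sub>n\<^sub>+\<^sub>1 - \<surd>((n + 1) / (n + 2)) h\<^sub>n\<close>; the first coefficient tends to \<open>0\<close> and the second stays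
  below \<open>1\<close>.\<close>

lemma Hermite_bound:
  assumes r: "r > 1"
  obtains K where "K > 0" "\<And>n. \<bar>qHermite 1 n x\<bar> \<le> K * r ^ n * sqrt (fact n)"
proof -
  define h where "h n = qHermite 1 n x / sqrt (fact n)" for n
  define L where "L n = max \<bar>h n\<bar> \<bar>h (Suc n)\<bar>" for n
  have h_rec: "h (Suc (Suc n)) = x / sqrt (real (n + 2)) * h (Suc n)
      - sqrt (real (n + 1)) / sqrt (real (n + 2)) * h n" for n
  proof -
    have s: "sqrt (fact (Suc (Suc n))) = sqrt (real (n + 2)) * (sqrt (real (n + 1)) * sqrt (fact n))"
      "sqrt (fact (Suc n)) = sqrt (real (n + 1)) * sqrt (fact n)"
      by (simp_all add: real_sqrt_mult)
    have nz: "sqrt (real (n + 2)) \<noteq> 0" "sqrt (real (n + 1)) \<noteq> 0" "sqrt (fact n) \<noteq> (0::real)" by auto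
    show ?thesis unfolding h_def s using nz
      by (simp add: field_simps del: of_nat_add of_nat_Suc)
  qed
  have "(\<lambda>n. \<bar>x\<bar> / sqrt (real (n + 2))) \<longlonglongrightarrow> 0"
    by (intro tendsto_divide_0[OF tendsto_const] filterlim_at_top_imp_at_infinity
        filterlim_compose[OF sqrt_at_top] filterlim_compose[OF filterlim_real_sequentially]
        filterlim_add_const_nat_at_top)
  then have "eventually (\<lambda>n. \<bar>x\<bar> / sqrt (real (n + 2)) < r - 1) sequentially"
    using r by (intro order_tendstoD) auto
  then have "eventually (\<lambda>n. L (Suc n) \<le> r * L n) sequentially"
  proof eventually_elim
    case (elim n)
    have "\<bar>h (Suc (Suc n))\<bar> \<le> \<bar>x\<bar> / sqrt (real (n + 2)) * \<bar>h (Suc n)\<bar>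
        + sqrt (real (n + 1)) / sqrt (real (n + 2)) * \<bar>h n\<bar>"
      unfolding h_rec by (rule order.trans[OF abs_triangle_ineq4]) (simp add: abs_mult)
    also have "\<dots> \<le> (r - 1) * L n + 1 * L n"
      using elim r by (intro add_mono mult_mono) (auto simp: L_def)
    finally have "\<bar>h (Suc (Suc n))\<bar> \<le> r * L n" by (simp add: algebra_simps)
    moreover have "\<bar>h (Suc n)\<bar> \<le> 1 * L n" by (simp add: L_def)
    moreover have "1 * L n \<le> r * L n" using r by (intro mult_right_mono) (auto simp: L_def)
    ultimately show ?case by (simp add: L_def)
  qed
  then obtain K where K: "K > 0" "\<And>n. L n \<le> K * r ^ n"
    using geometric_bound[of r L] r by auto
  have "\<bar>qHermite 1 n x\<bar> \<le> K * r ^ n * sqrt (fact n)" for n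
  proof -
    have "\<bar>h n\<bar> \<le> L n" by (simp add: L_def)
    then have "\<bar>h n\<bar> \<le> K * r ^ n" using K(2)[of n] by linarith
    then show ?thesis by (simp add: h_def pos_divide_le_eq)
  qed
  with K(1) show ?thesis by (rule that)
qed

text \<open>Raising the index by a fixed \<open>m\<close> costs a polynomial factor in \<open>n\<close>, which a slightly larger
  \<open>r\<close> absorbs.\<close>

lemma Hermite_shift_bound:
  assumes r: "r > 1"
  obtains K where "K > 0" "\<And>n. \<bar>qHermite 1 (n + m) x\<bar> \<le> K * r ^ n * sqrt (fact n)"
proof -
  have "\<exists>K>0. \<forall>n. \<bar>qHermite 1 (n + m) x\<bar> \<le> K * r ^ n * sqrt (fact n)" if "r > 1" for r
    using that
  proof (induction m arbitrary: r)
    case 0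
    then show ?case using Hermite_bound[of r x] by (metis add_0_right)
  next
    case (Suc m)
    define t where "t = sqrt r"
    have t: "t > 1" "t * t = r" using Suc.prems by (auto simp: t_def)
    then obtain K where K: "K > 0" "\<And>n. \<bar>qHermite 1 (n + m) x\<bar> \<le> K * t ^ n * sqrt (fact n)"
      using Suc.IH[of t] by auto
    have "(\<lambda>n. 1 / (real n + 1)) \<longlonglongrightarrow> 0"
      using LIMSEQ_inverse_real_of_nat by (simp add: inverse_eq_divide add.commute)
    then have "eventually (\<lambda>n. 1 / (real n + 1) < t - 1) sequentially"
      using t by (intro order_tendstoD) auto
    then have "eventually (\<lambda>n. real (Suc n) + 1 \<le> t * (real n + 1)) sequentially"
      by eventually_elim (simp add: field_simps)
    then obtain M where M: "M > 0" "\<And>n. real n + 1 \<le> M * t ^ n"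
      using geometric_bound[of t "\<lambda>n. real n + 1"] t by auto
    have "\<bar>qHermite 1 (n + Suc m) x\<bar> \<le> (K * t * M) * r ^ n * sqrt (fact n)" for n
    proof -
      have "\<bar>qHermite 1 (n + Suc m) x\<bar> \<le> K * t ^ Suc n * sqrt (fact (Suc n))"
        using K(2)[of "Suc n"] by simp
      also have "sqrt (fact (Suc n)) = sqrt (fact n) * sqrt (real n + 1)"
        by (simp add: algebra_simps flip: real_sqrt_mult)
      also have "K * t ^ Suc n * (sqrt (fact n) * sqrt (real n + 1))
          = K * t ^ Suc n * sqrt (fact n) * sqrt (real n + 1)" by simp
      also have "sqrt (real n + 1) \<le> real n + 1"
        by (rule real_le_lsqrt) (auto simp: power2_eq_square algebra_simps)
      also have "real n + 1 \<le> M * t ^ n" by (rule M)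
      finally show ?thesis using K(1) t(1) t(2)[symmetric]
        by (simp add: mult_ac power_mult_distrib mult_left_mono)
    qed
    then show ?case using K M t by (intro exI[of _ "K * t * M"]) auto
  qed
  then show ?thesis using r that by blast
qed

text \<open>The individual rates \<open>u\<close> of \<open>H\<^sub>n\<close> and \<open>v\<close> of \<open>1 / [n]!\<close> are near \<open>(1 - q)\<^bsup>-1/2\<^esup>\<close> and \<open>1 - q\<close>.
  Only \<open>u\<^sup>2 v\<close> matters: in each series below an index occurs in two polynomials and one factorial.\<close>

lemma growth_rates:
  assumes q: "\<bar>q\<bar> < 1" and R: "R > 1"
  obtains u v where "u > 0" "v > 0" "u * u * v = R"
    "\<And>x. x \<in> S q \<Longrightarrow> \<exists>K>0. \<forall>n. \<bar>qHermite q n x\<bar> \<le> K * u ^ n"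
    "\<exists>K>0. \<forall>n. 1 / qfact q n \<le> K * v ^ n"
proof -
  define r where "r = root 3 R"
  have r: "r > 1" "r ^ 3 = R" using R by (simp_all add: r_def)
  have s: "sqrt (1 - q) > 0" "sqrt (1 - q) * sqrt (1 - q) = 1 - q" "1 - q > 0" using q by auto
  show ?thesis
  proof (rule that[of "r / sqrt (1 - q)" "r * (1 - q)"])
    show "r / sqrt (1 - q) * (r / sqrt (1 - q)) * (r * (1 - q)) = R"
      using s by (simp add: r(2)[symmetric] power3_eq_cube)
    show "\<exists>K>0. \<forall>n. \<bar>qHermite q n x\<bar> \<le> K * (r / sqrt (1 - q)) ^ n" if "x \<in> S q" for x
      using qHermite_bound[OF q that r(1)] by metis
    show "\<exists>K>0. \<forall>n. 1 / qfact q n \<le> K * (r * (1 - q)) ^ n"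
      using inverse_qfact_bound[OF q r(1)] by metis
  qed (use r s in auto)
qed

lemma one_minus_square_pos:
  fixes q \<rho> :: real
  assumes "-1 < q" "q \<le> 1" "\<bar>\<rho>\<bar> < 1"
  shows "1 - \<rho>\<^sup>2 * q ^ n > 0"
proof -
  have "\<bar>\<rho>\<^sup>2 * q ^ n\<bar> \<le> \<rho>\<^sup>2 * 1"
    unfolding abs_mult power_abs using assms by (intro mult_mono power_le_one) auto
  also have "\<rho>\<^sup>2 < 1" using assms by (simp add: abs_square_less_1)
  finally show ?thesis by simp
qed

lemma qpoch_Suc: "qpoch q a (Suc n) = qpoch q a n * (1 - a * q ^ n)"
  by (simp add: qpoch_def)

lemma qpoch_square_pos: "-1 < q \<Longrightarrow> q \<le> 1 \<Longrightarrow> \<bar>\<rho>\<bar> < 1 \<Longrightarrow> qpoch q (\<rho>\<^sup>2) n > 0"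
  unfolding qpoch_def by (intro prod_pos one_minus_square_pos ballI)

section \<open>The kernels gamma\<close>

definition gam_term :: "real \<Rightarrow> nat \<Rightarrow> nat \<Rightarrow> real \<Rightarrow> real \<Rightarrow> real \<Rightarrow> nat \<Rightarrow> real" where
  "gam_term q m k x y \<rho> i = \<rho> ^ i / qfact q i * qHermite q (i + m) x * qHermite q (i + k) y"

lemma gam_eq_suminf: "gam q m k x y \<rho> = (\<Sum>i. gam_term q m k x y \<rho> i)"
  by (simp add: gam_def gam_term_def)

lemma gam_commute: "gam q m k x y \<rho> = gam q k m y x \<rho>"
  by (simp add: gam_def mult_ac)

text \<open>The majorant is geometric with ratio \<open>|\<rho>| R\<close>; \<open>R = 2 / (1 + |\<rho>|)\<close> satisfies \<open>R > 1\<close> and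
  \<open>|\<rho>| R < 1\<close>.\<close>

lemma summable_norm_gam_term:
  assumes q: "-1 < q" "q \<le> 1" and xy: "x \<in> S q" "y \<in> S q" and \<rho>: "\<bar>\<rho>\<bar> < 1"
  shows "summable (\<lambda>i. norm (gam_term q m k x y \<rho> i))"
proof -
  define R where "R = 2 / (1 + \<bar>\<rho>\<bar>)"
  have R: "R > 1" "\<bar>\<rho>\<bar> * R < 1" using \<rho> by (simp_all add: R_def field_simps)
  have "\<exists>K. \<forall>i. norm (gam_term q m k x y \<rho> i) \<le> K * (\<bar>\<rho>\<bar> * R) ^ i"
  proof (cases "q = 1")
    case False
    with q have q': "\<bar>q\<bar> < 1" by auto
    from growth_rates[OF q' R(1)] obtain u v where uv: "u > 0" "v > 0" "u * u * v = R"
      and H: "\<And>x. x \<in> S q \<Longrightarrow> \<exists>K>0. \<forall>n. \<bar>qHermite q n x\<bar> \<le> K * u ^ n"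
      and F: "\<exists>K>0. \<forall>n. 1 / qfact q n \<le> K * v ^ n" by metis
    obtain Kx where Kx: "Kx > 0" "\<And>n. \<bar>qHermite q n x\<bar> \<le> Kx * u ^ n" using H[OF xy(1)] by auto
    obtain Ky where Ky: "Ky > 0" "\<And>n. \<bar>qHermite q n y\<bar> \<le> Ky * u ^ n" using H[OF xy(2)] by auto
    obtain K where K: "K > 0" "\<And>n. 1 / qfact q n \<le> K * v ^ n" using F by auto
    have "norm (gam_term q m k x y \<rho> i) \<le> (K * Kx * Ky * u ^ m * u ^ k) * (\<bar>\<rho>\<bar> * R) ^ i" for i
    proof -
      have "norm (gam_term q m k x y \<rho> i)
          = \<bar>\<rho>\<bar> ^ i * (1 / qfact q i) * \<bar>qHermite q (i + m) x\<bar> * \<bar>qHermite q (i + k) y\<bar>"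
        using qfact_pos[OF q, of i] by (simp add: gam_term_def abs_mult power_abs)
      also have "\<dots> \<le> \<bar>\<rho>\<bar> ^ i * (K * v ^ i) * (Kx * u ^ (i + m)) * (Ky * u ^ (i + k))"
        using qfact_pos[OF q, of i] uv K Kx Ky
        by (intro mult_mono mult_nonneg_nonneg) auto
      also have "\<dots> = (K * Kx * Ky * u ^ m * u ^ k) * (\<bar>\<rho>\<bar> * R) ^ i"
        by (simp add: uv(3)[symmetric] power_mult_distrib power_add mult_ac)
      finally show ?thesis .
    qed
    then show ?thesis by blast
  next
    case True
    define r where "r = sqrt R"
    have r: "r > 1" "r * r = R" using R by (auto simp: r_def)
    obtain Kx where Kx: "Kx > 0" "\<And>n. \<bar>qHermite 1 (n + m) x\<bar> \<le> Kx * r ^ n * sqrt (fact n)"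
      using Hermite_shift_bound[OF r(1)] by metis
    obtain Ky where Ky: "Ky > 0" "\<And>n. \<bar>qHermite 1 (n + k) y\<bar> \<le> Ky * r ^ n * sqrt (fact n)"
      using Hermite_shift_bound[OF r(1)] by metis
    have "norm (gam_term q m k x y \<rho> i) \<le> (Kx * Ky) * (\<bar>\<rho>\<bar> * R) ^ i" for i
    proof -
      have "norm (gam_term q m k x y \<rho> i)
          = \<bar>\<rho>\<bar> ^ i / fact i * \<bar>qHermite 1 (i + m) x\<bar> * \<bar>qHermite 1 (i + k) y\<bar>"
        using True by (simp add: gam_term_def abs_mult power_abs qfact_one)
      also have "\<dots> \<le> \<bar>\<rho>\<bar> ^ i / fact i * (Kx * r ^ i * sqrt (fact i)) * (Ky * r ^ i * sqrt (fact i))"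
        using Kx Ky r by (intro mult_mono mult_nonneg_nonneg) auto
      also have "\<dots> = (Kx * Ky) * (\<bar>\<rho>\<bar> * R) ^ i * (sqrt (fact i) * sqrt (fact i) / fact i)"
        unfolding r(2)[symmetric] by (simp add: power_mult_distrib mult_ac del: real_sqrt_mult_self)
      also have "sqrt (fact i) * sqrt (fact i) / fact i = (1::real)" by simp
      finally show ?thesis by simp
    qed
    then show ?thesis by blast
  qed
  then obtain K where K: "\<And>i. norm (gam_term q m k x y \<rho> i) \<le> K * (\<bar>\<rho>\<bar> * R) ^ i" by blast
  have "summable (\<lambda>i. K * (\<bar>\<rho>\<bar> * R) ^ i)"
    using R by (intro summable_mult summable_geometric) (simp add: abs_mult)
  then show ?thesis
    by (rule summable_comparison_test'[where N = 0]) (use K in simp)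
qed

lemmas summable_gam_term = summable_norm_cancel[OF summable_norm_gam_term]

context
  fixes q x y \<rho> :: real
  assumes q: "-1 < q" "q \<le> 1" and xy: "x \<in> S q" "y \<in> S q" and \<rho>: "\<bar>\<rho>\<bar> < 1"
begin

lemma gam_term_sums: "gam_term q m k x y \<rho> sums gam q m k x y \<rho>"
  unfolding gam_eq_suminf by (intro summable_sums summable_gam_term q xy \<rho>)

text \<open>The recurrence for \<open>H\<^sub>i\<^sub>+\<^sub>m\<^sub>+\<^sub>1(x)\<close> under the sum, with \<open>[i + m] = [m] + q\<^sup>m [i]\<close>.  The part
  with \<open>[i]\<close> cancels a factor of \<open>[i]!\<close>, and shifting \<open>i\<close> by one turns it into \<open>\<rho> \<gamma>\<^sub>m\<^sub>,\<^sub>k\<^sub>+\<^sub>1\<close>.\<close>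

lemma gam_Suc_left:
  "gam q (Suc m) k x y \<rho> =
     x * gam q m k x y \<rho> - qint q m * gam q (m - 1) k x y \<rho> - q ^ m * \<rho> * gam q m (Suc k) x y \<rho>"
proof -
  \<comment> \<open>the part with \<open>[i]\<close>: it vanishes at \<open>i = 0\<close>, so it is a shifted series\<close>
  define s where "s i = \<rho> ^ i / qfact q i * qint q i * qHermite q (i + m - 1) x * qHermite q (i + k) y"
    for i
  have "s (Suc i) = \<rho> * gam_term q m (Suc k) x y \<rho> i" for i
    using qint_pos[OF q, of "Suc i"] qfact_pos[OF q, of i]
    by (simp add: s_def gam_term_def qfact_Suc)
  moreover have "s 0 = 0" by (simp add: s_def)
  ultimately have s: "s sums (\<rho> * gam q m (Suc k) x y \<rho>)"
    using sums_Suc[of s] sums_mult[OF gam_term_sums[of m "Suc k"], of \<rho>] by simp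
  have "gam_term q (Suc m) k x y \<rho> i =
      x * gam_term q m k x y \<rho> i - qint q m * gam_term q (m - 1) k x y \<rho> i - q ^ m * s i" for i
  proof -
    have "qHermite q (i + Suc m) x =
        x * qHermite q (i + m) x - (qint q m + q ^ m * qint q i) * qHermite q (i + m - 1) x"
      using qHermite_Suc[of q "i + m" x] qint_add[of q m i] by (simp add: add.commute)
    moreover have "qint q m * qHermite q (i + m - 1) x = qint q m * qHermite q (i + (m - 1)) x"
      by (cases m) simp_all
    ultimately have H: "qHermite q (i + Suc m) x = x * qHermite q (i + m) x
        - qint q m * qHermite q (i + (m - 1)) x - q ^ m * qint q i * qHermite q (i + m - 1) x"
      by (simp only: distrib_right diff_diff_eq)
    show ?thesis unfolding gam_term_def s_def H by (simp add: algebra_simps)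
  qed
  then have "gam_term q (Suc m) k x y \<rho> sums (x * gam q m k x y \<rho>
      - qint q m * gam q (m - 1) k x y \<rho> - q ^ m * (\<rho> * gam q m (Suc k) x y \<rho>))"
    using sums_diff[OF sums_diff[OF sums_mult[OF gam_term_sums[of m k]]
        sums_mult[OF gam_term_sums[of "m - 1" k]]] sums_mult[OF s]] by presburger
  then show ?thesis using sums_unique2[OF gam_term_sums] by (simp add: mult.assoc)
qed

end

context
  fixes q x y \<rho> :: real
  assumes q: "-1 < q" "q \<le> 1" and xy: "x \<in> S q" "y \<in> S q" and \<rho>: "\<bar>\<rho>\<bar> < 1"
begin

lemma gam_Suc_right:
  "gam q m (Suc k) x y \<rho> =
     y * gam q m k x y \<rho> - qint q k * gam q m (k - 1) x y \<rho> - q ^ k * \<rho> * gam q (Suc m) k x y \<rho>"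
  using gam_Suc_left[OF q xy(2,1) \<rho>, of k m] by (simp add: gam_commute[of q _ _ y x])

text \<open>For \<open>k = 0\<close> the right-hand recurrence has no term with \<open>k - 1\<close>, so \<open>\<gamma>\<^sub>m\<^sub>,\<^sub>1\<close> can be eliminated.
  The result is the Al-Salam--Chihara recurrence for \<open>(\<rho>\<^sup>2)\<^sub>m \<gamma>\<^sub>m\<^sub>,\<^sub>0\<close>.\<close>

lemma gam_Suc_0:
  "(1 - \<rho>\<^sup>2 * q ^ m) * gam q (Suc m) 0 x y \<rho> =
     (x - \<rho> * y * q ^ m) * gam q m 0 x y \<rho> - qint q m * gam q (m - 1) 0 x y \<rho>"
  using gam_Suc_left[OF q xy \<rho>, of m 0] gam_Suc_right[of m 0]
  by (simp add: algebra_simps power2_eq_square)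

lemma gam_ASC: "gam q m 0 x y \<rho> = ASC q m x y \<rho> / qpoch q (\<rho>\<^sup>2) m * gam q 0 0 x y \<rho>"
proof (induction m rule: less_induct)
  case (less m)
  show ?case
  proof (cases m)
    case 0
    then show ?thesis by (simp add: qpoch_def)
  next
    case (Suc n)
    define g where "g = gam q 0 0 x y \<rho>"
    define p where "p = qpoch q (\<rho>\<^sup>2)"
    have p: "p k > 0" for k unfolding p_def by (rule qpoch_square_pos[OF q \<rho>])
    have pS: "p (Suc k) = p k * (1 - \<rho>\<^sup>2 * q ^ k)" for k by (simp add: p_def qpoch_Suc)
    have 1: "gam q n 0 x y \<rho> * p n = ASC q n x y \<rho> * g"
      using less[of n] Suc p[of n] by (simp add: g_def p_def)
    have 2: "qint q n * gam q (n - 1) 0 x y \<rho> * p n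
        = (1 - \<rho>\<^sup>2 * q ^ (n - 1)) * qint q n * ASC q (n - 1) x y \<rho> * g"
    proof (cases n)
      case (Suc k)
      then have "gam q k 0 x y \<rho> * p k = ASC q k x y \<rho> * g"
        using less[of k] \<open>m = Suc n\<close> p[of k] by (simp add: g_def p_def)
      then show ?thesis using Suc by (simp add: pS mult_ac)
    qed simp
    have "gam q (Suc n) 0 x y \<rho> * p (Suc n) = (1 - \<rho>\<^sup>2 * q ^ n) * gam q (Suc n) 0 x y \<rho> * p n"
      by (simp add: pS)
    also have "\<dots> = (x - \<rho> * y * q ^ n) * (gam q n 0 x y \<rho> * p n) - qint q n * gam q (n - 1) 0 x y \<rho> * p n"
      unfolding gam_Suc_0 by (simp add: algebra_simps)
    also have "\<dots> = ASC q (Suc n) x y \<rho> * g"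
      unfolding 1 2 ASC_Suc by (simp add: algebra_simps)
    finally have "gam q (Suc n) 0 x y \<rho> * p (Suc n) = ASC q (Suc n) x y \<rho> * g" .
    then show ?thesis using Suc p[of "Suc n"] by (simp add: g_def p_def field_simps)
  qed
qed

text \<open>As \<open>\<gamma>\<^sub>1\<^sub>,\<^sub>1\<close> is the q-derivative of \<open>\<gamma>\<^sub>0\<^sub>,\<^sub>0\<close> with respect to \<open>\<rho>\<close> (the ordinary derivative for
  \<open>q = 1\<close>), this is an equation for \<open>\<gamma>\<^sub>0\<^sub>,\<^sub>0\<close> as a function of \<open>\<rho>\<close>.  It comes from
  \<open>\<gamma>\<^sub>1\<^sub>,\<^sub>1 = y \<gamma>\<^sub>1\<^sub>,\<^sub>0 - \<rho> \<gamma>\<^sub>2\<^sub>,\<^sub>0\<close> and the recurrence for \<open>\<gamma>\<^sub>m\<^sub>,\<^sub>0\<close>.\<close>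

lemma gam_1_1:
  "(1 - \<rho>\<^sup>2) * (1 - q * \<rho>\<^sup>2) * gam q 1 1 x y \<rho> =
     (y * (x - \<rho> * y) * (1 - q * \<rho>\<^sup>2) - \<rho> * ((x - \<rho> * y * q) * (x - \<rho> * y) - (1 - \<rho>\<^sup>2)))
       * gam q 0 0 x y \<rho>"
proof -
  define g where "g = gam q 0 0 x y \<rho>"
  have g11: "gam q 1 1 x y \<rho> = y * gam q 1 0 x y \<rho> - \<rho> * gam q 2 0 x y \<rho>"
    using gam_Suc_right[of 1 0] by (simp add: numeral_2_eq_2)
  have 1: "(1 - \<rho>\<^sup>2) * gam q 1 0 x y \<rho> = (x - \<rho> * y) * g"
    using gam_Suc_0[of 0] by (simp add: g_def)
  have 2: "(1 - q * \<rho>\<^sup>2) * gam q 2 0 x y \<rho> = (x - \<rho> * y * q) * gam q 1 0 x y \<rho> - g"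
    using gam_Suc_0[of 1] by (simp add: g_def numeral_2_eq_2 qint_def mult.commute)
  have "(1 - \<rho>\<^sup>2) * (1 - q * \<rho>\<^sup>2) * gam q 1 1 x y \<rho> =
      y * (1 - q * \<rho>\<^sup>2) * ((1 - \<rho>\<^sup>2) * gam q 1 0 x y \<rho>)
      - \<rho> * (1 - \<rho>\<^sup>2) * ((1 - q * \<rho>\<^sup>2) * gam q 2 0 x y \<rho>)"
    unfolding g11 by (simp add: algebra_simps)
  also have "\<dots> = y * (1 - q * \<rho>\<^sup>2) * ((1 - \<rho>\<^sup>2) * gam q 1 0 x y \<rho>)
      - \<rho> * ((x - \<rho> * y * q) * ((1 - \<rho>\<^sup>2) * gam q 1 0 x y \<rho>) - (1 - \<rho>\<^sup>2) * g)"
    unfolding 2 by (simp add: algebra_simps)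
  also have "\<dots> = (y * (x - \<rho> * y) * (1 - q * \<rho>\<^sup>2)
      - \<rho> * ((x - \<rho> * y * q) * (x - \<rho> * y) - (1 - \<rho>\<^sup>2))) * g"
    unfolding 1 by (simp add: algebra_simps)
  finally show ?thesis by (simp add: g_def)
qed

end

section \<open>The Poisson--Mehler formula\<close>

lemma gam_powser:
  "gam q m k x y \<rho> = (\<Sum>i. (qHermite q (i + m) x * qHermite q (i + k) y / qfact q i) * \<rho> ^ i)"
  by (simp add: gam_def mult_ac)

lemma gam_0_0_powser_summable:
  assumes "-1 < q" "q \<le> 1" "x \<in> S q" "y \<in> S q" "\<bar>\<rho>\<bar> < 1"
  shows "summable (\<lambda>i. (qHermite q i x * qHermite q i y / qfact q i) * \<rho> ^ i)"
  using summable_gam_term[OF assms, of 0 0] by (simp add: gam_term_def[abs_def] mult_ac)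

text \<open>The series of \<open>\<gamma>\<^sub>0\<^sub>,\<^sub>0(\<rho>) - \<gamma>\<^sub>0\<^sub>,\<^sub>0(\<rho> q)\<close> has the factors \<open>1 - q\<^sup>i = (1 - q) [i]\<close>, hence it equals
  \<open>(1 - q) \<rho> \<gamma>\<^sub>1\<^sub>,\<^sub>1(\<rho>)\<close>; the equation of \<open>\<gamma>\<^sub>1\<^sub>,\<^sub>1\<close> does the rest.\<close>

lemma gam_functional_equation:
  assumes q: "\<bar>q\<bar> < 1" and xy: "x \<in> S q" "y \<in> S q" and \<rho>: "\<bar>\<rho>\<bar> < 1"
  shows "v0 q x y \<rho> * gam q 0 0 x y \<rho> = (1 - \<rho>\<^sup>2) * (1 - q * \<rho>\<^sup>2) * gam q 0 0 x y (\<rho> * q)"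
proof -
  have q': "-1 < q" "q \<le> 1" using q by auto
  have \<rho>q: "\<bar>\<rho> * q\<bar> < 1" using \<rho> q by (simp add: abs_mult) (metis abs_ge_zero abs_of_nonneg less_eq_real_def mult_strict_mono' mult_1)
  define s where "s i = gam_term q 0 0 x y \<rho> i - gam_term q 0 0 x y (\<rho> * q) i" for i
  have "s (Suc i) = (1 - q) * \<rho> * gam_term q 1 1 x y \<rho> i" for i
  proof -
    have "s (Suc i) = (1 - q ^ Suc i) / qfact q (Suc i) * \<rho> ^ Suc i
        * qHermite q (Suc i) x * qHermite q (Suc i) y"
      by (simp add: s_def gam_term_def power_mult_distrib diff_divide_distrib algebra_simps del: qHermite.simps)
    also have "(1 - q ^ Suc i) / qfact q (Suc i) = (1 - q) / qfact q i"
      using qint_pos[OF q', of "Suc i"] unfolding qfact_Suc qint_times[symmetric] by simp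
    finally show ?thesis by (simp add: gam_term_def del: qHermite.simps)
  qed
  moreover have "s 0 = 0" by (simp add: s_def gam_term_def)
  ultimately have "s sums ((1 - q) * \<rho> * gam q 1 1 x y \<rho>)"
    using sums_Suc[of s] sums_mult[OF gam_term_sums[OF q' xy \<rho>, of 1 1], of "(1 - q) * \<rho>"] by simp
  moreover have "s sums (gam q 0 0 x y \<rho> - gam q 0 0 x y (\<rho> * q))"
    unfolding s_def by (intro sums_diff gam_term_sums q' xy \<rho> \<rho>q)
  ultimately have "(1 - q) * \<rho> * gam q 1 1 x y \<rho> = gam q 0 0 x y \<rho> - gam q 0 0 x y (\<rho> * q)"
    by (rule sums_unique2)
  then have diff: "gam q 0 0 x y (\<rho> * q) = gam q 0 0 x y \<rho> - (1 - q) * \<rho> * gam q 1 1 x y \<rho>"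
    by linarith
  have "(1 - \<rho>\<^sup>2) * (1 - q * \<rho>\<^sup>2) * gam q 0 0 x y (\<rho> * q) =
      (1 - \<rho>\<^sup>2) * (1 - q * \<rho>\<^sup>2) * gam q 0 0 x y \<rho>
      - (1 - q) * \<rho> * ((1 - \<rho>\<^sup>2) * (1 - q * \<rho>\<^sup>2) * gam q 1 1 x y \<rho>)"
    unfolding diff by (simp add: algebra_simps)
  also have "\<dots> = v0 q x y \<rho> * gam q 0 0 x y \<rho>"
    unfolding gam_1_1[OF q' xy \<rho>] v0_def by (simp add: algebra_simps power2_eq_square)
  finally show ?thesis by simp
qed

lemma qpoch_inf:
  assumes q: "\<bar>q\<bar> < 1" and a: "\<bar>a\<bar> < 1"
  shows "(\<lambda>n. qpoch q a n) \<longlonglongrightarrow> qpoch_inf q a" and "qpoch_inf q a \<noteq> 0"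
proof -
  have "summable (\<lambda>i. norm ((1 - a * q ^ i) - 1))"
    using q by (simp add: abs_mult power_abs summable_mult)
  then have cp: "convergent_prod (\<lambda>i. 1 - a * q ^ i)"
    by (intro abs_convergent_prod_imp_convergent_prod summable_imp_abs_convergent_prod)
  have ne: "1 - a * q ^ i \<noteq> 0" for i
  proof -
    have "\<bar>a * q ^ i\<bar> \<le> \<bar>a\<bar> * 1"
      unfolding abs_mult power_abs using q by (intro mult_mono power_le_one) auto
    then show ?thesis using a by auto
  qed
  from cp ne show "qpoch_inf q a \<noteq> 0" unfolding qpoch_inf_def by (rule prodinf_nonzero)
  from convergent_prod_LIMSEQ[OF cp] have "(\<lambda>n. qpoch q a (Suc n)) \<longlonglongrightarrow> qpoch_inf q a"
    by (simp add: qpoch_def qpoch_inf_def lessThan_Suc_atMost)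
  then show "(\<lambda>n. qpoch q a n) \<longlonglongrightarrow> qpoch_inf q a" by (rule LIMSEQ_imp_Suc)
qed

context
  fixes q x y \<rho> :: real
  assumes q: "\<bar>q\<bar> < 1" and xy: "x \<in> S q" "y \<in> S q" and \<rho>: "\<bar>\<rho>\<bar> < 1"
begin

private lemma q': "-1 < q" "q \<le> 1" using q by auto

private lemma \<rho>q: "\<bar>\<rho> * q ^ n\<bar> < 1"
proof -
  have "\<bar>\<rho> * q ^ n\<bar> \<le> \<bar>\<rho>\<bar> * 1"
    unfolding abs_mult power_abs using q by (intro mult_mono power_le_one) auto
  then show ?thesis using \<rho> by simp
qed

lemma gam_tendsto_1: "(\<lambda>n. gam q 0 0 x y (\<rho> * q ^ n)) \<longlonglongrightarrow> 1"
proof -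
  define c where "c i = qHermite q i x * qHermite q i y / qfact q i" for i
  have "isCont (\<lambda>z. \<Sum>i. c i * z ^ i) 0"
    by (rule isCont_powser[of _ "1 / 2"])
       (use gam_0_0_powser_summable[OF q' xy, of "1 / 2"] in \<open>simp_all add: c_def\<close>)
  moreover have "(\<lambda>n. \<rho> * q ^ n) \<longlonglongrightarrow> 0"
    using tendsto_mult_left[OF LIMSEQ_abs_realpow_zero2[OF q], of \<rho>] by simp
  ultimately have "(\<lambda>n. \<Sum>i. c i * (\<rho> * q ^ n) ^ i) \<longlonglongrightarrow> (\<Sum>i. c i * 0 ^ i)"
    by (rule isCont_tendsto_compose)
  moreover have "(\<Sum>i. c i * 0 ^ i) = 1" unfolding powser_zero by (simp add: c_def)
  ultimately show ?thesis by (simp add: gam_powser c_def)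
qed

lemma gam_iterate:
  "gam q 0 0 x y \<rho> * (\<Prod>k<n. v0 q x y (\<rho> * q ^ k)) =
     qpoch q (\<rho>\<^sup>2) (2 * n) * gam q 0 0 x y (\<rho> * q ^ n)"
proof (induction n)
  case (Suc n)
  have "gam q 0 0 x y \<rho> * (\<Prod>k<Suc n. v0 q x y (\<rho> * q ^ k))
      = qpoch q (\<rho>\<^sup>2) (2 * n) * (v0 q x y (\<rho> * q ^ n) * gam q 0 0 x y (\<rho> * q ^ n))"
    using Suc by (simp add: mult_ac)
  also have "v0 q x y (\<rho> * q ^ n) * gam q 0 0 x y (\<rho> * q ^ n) =
      (1 - \<rho>\<^sup>2 * q ^ (2 * n)) * (1 - \<rho>\<^sup>2 * q ^ Suc (2 * n)) * gam q 0 0 x y (\<rho> * q ^ Suc n)"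
    unfolding gam_functional_equation[OF q xy \<rho>q]
    by (simp add: power_mult_distrib power_mult mult_ac flip: power_mult)
  finally show ?case by (simp add: qpoch_Suc mult_ac)
qed (simp add: qpoch_def)

text \<open>A zero at \<open>\<rho>\<close> would propagate along \<open>\<rho> q\<^sup>n\<close> to the limit \<open>\<gamma>\<^sub>0\<^sub>,\<^sub>0(x, y|0) = 1\<close>.\<close>

lemma gam_nonzero_inside: "gam q 0 0 x y \<rho> \<noteq> 0"
proof
  assume "gam q 0 0 x y \<rho> = 0"
  then have "gam q 0 0 x y (\<rho> * q ^ n) = 0" for n
    using gam_iterate[of n] qpoch_square_pos[OF q' \<rho>, of "2 * n"] by simp
  then show False using gam_tendsto_1 by (simp add: LIMSEQ_const_iff)
qed

text \<open>A zero of \<open>v\<^sub>0\<close> is impossible for the same reason: it would force a zero of \<open>\<gamma>\<^sub>0\<^sub>,\<^sub>0\<close> at all later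
  points \<open>\<rho> q\<^sup>n\<close>.\<close>

lemma v0_nonzero: "v0 q x y (\<rho> * q ^ k) \<noteq> 0"
proof
  assume "v0 q x y (\<rho> * q ^ k) = 0"
  then have Z: "gam q 0 0 x y (\<rho> * q ^ n) = 0" if "n > k" for n
  proof -
    have 0: "(\<Prod>k<n. v0 q x y (\<rho> * q ^ k)) = 0"
      using \<open>v0 q x y (\<rho> * q ^ k) = 0\<close> that by (intro prod_zero) auto
    show ?thesis
      using gam_iterate[of n] qpoch_square_pos[OF q' \<rho>, of "2 * n"] unfolding 0 by simp
  qed
  have "(\<lambda>n. 0) \<longlonglongrightarrow> (1::real)"
    by (rule Lim_transform_eventually[OF gam_tendsto_1])
       (use Z in \<open>auto intro: eventually_mono[OF eventually_gt_at_top[of k]]\<close>)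
  then show False by (simp add: LIMSEQ_const_iff)
qed

text \<open>Iterating the functional equation \<open>n\<close> times gives the \<open>n\<close>-th partial product explicitly; its
  limit is nonzero, which is what convergence of an infinite product requires.\<close>

lemma Poisson_Mehler_q:
  "qpoch_inf q (\<rho>\<^sup>2) * (\<Prod>k. 1 / v0 q x y (\<rho> * q ^ k)) = gam q 0 0 x y \<rho>"
proof -
  have sq: "\<bar>\<rho>\<^sup>2\<bar> < 1" using \<rho> by (simp add: abs_square_less_1)
  define L where "L = gam q 0 0 x y \<rho> / (qpoch_inf q (\<rho>\<^sup>2) * 1)"
  have "(\<lambda>n. gam q 0 0 x y \<rho> / (qpoch q (\<rho>\<^sup>2) (2 * n) * gam q 0 0 x y (\<rho> * q ^ n))) \<longlonglongrightarrow> L"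
    unfolding L_def
    by (intro tendsto_intros gam_tendsto_1 filterlim_compose[OF qpoch_inf(1)[OF q sq]]
         mult_nat_left_at_top) (use qpoch_inf(2)[OF q sq] in auto)
  also have "(\<lambda>n. gam q 0 0 x y \<rho> / (qpoch q (\<rho>\<^sup>2) (2 * n) * gam q 0 0 x y (\<rho> * q ^ n)))
      = (\<lambda>n. \<Prod>k<n. 1 / v0 q x y (\<rho> * q ^ k))"
    using gam_nonzero_inside v0_nonzero unfolding gam_iterate[symmetric]
    by (simp add: prod_dividef)
  finally have "(\<lambda>n. \<Prod>k\<le>n. 1 / v0 q x y (\<rho> * q ^ k)) \<longlonglongrightarrow> L"
    unfolding lessThan_Suc_atMost[symmetric] by (rule LIMSEQ_Suc)
  moreover have "L \<noteq> 0" using gam_nonzero_inside qpoch_inf(2)[OF q sq] by (simp add: L_def)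
  ultimately have "(\<lambda>k. 1 / v0 q x y (\<rho> * q ^ k)) has_prod L"
    by (simp add: has_prod_def raw_has_prod_def)
  then show ?thesis using qpoch_inf(2)[OF q sq] by (simp add: L_def flip: has_prod_unique)
qed

end

text \<open>For \<open>q = 1\<close>, \<open>gam_1_1\<close> is a linear differential equation in \<open>\<rho>\<close>, and \<open>e\<^sup>E\<close> is its integrating
  factor: \<open>\<gamma>\<^sub>0\<^sub>,\<^sub>0 e\<^sup>E\<close> is constant on \<open>(-1, 1)\<close>.\<close>

lemma Mehler:
  assumes \<rho>: "\<bar>\<rho>\<bar> < 1"
  shows "gam 1 0 0 x y \<rho> =
    exp (- (\<rho>\<^sup>2 * x\<^sup>2 - 2 * \<rho> * x * y + \<rho>\<^sup>2 * y\<^sup>2) / (2 * (1 - \<rho>\<^sup>2))) / sqrt (1 - \<rho>\<^sup>2)"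
proof -
  define E where "E r = (r\<^sup>2 * x\<^sup>2 - 2 * r * x * y + r\<^sup>2 * y\<^sup>2) / (2 * (1 - r\<^sup>2)) + ln (1 - r\<^sup>2) / 2"
    for r :: real
  have q: "-1 < (1::real)" "1 \<le> (1::real)" and xy: "x \<in> S 1" "y \<in> S 1" by (auto simp: S_def)
  have deriv: "((\<lambda>r. gam 1 0 0 x y r * exp (E r)) has_real_derivative 0) (at r)"
    if "r \<in> {-1<..<1}" for r
  proof -
    have r: "\<bar>r\<bar> < 1" using that by auto
    then have p: "1 - r\<^sup>2 > 0" by (simp add: abs_square_less_1)
    define c where "c i = qHermite 1 i x * qHermite 1 i y / qfact 1 i" for i
    have "((\<lambda>z. \<Sum>i. c i * z ^ i) has_field_derivative (\<Sum>i. diffs c i * r ^ i)) (at r)"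
      by (rule termdiffs_strong'[of 1])
         (use gam_0_0_powser_summable[OF q xy] r in \<open>auto simp: c_def\<close>)
    moreover have "diffs c i = qHermite 1 (i + 1) x * qHermite 1 (i + 1) y / qfact 1 i" for i
      by (simp add: diffs_def c_def qfact_Suc del: of_nat_Suc qHermite.simps)
    ultimately have G': "((\<lambda>z. gam 1 0 0 x y z) has_field_derivative gam 1 1 1 x y r) (at r)"
      by (simp add: gam_powser c_def)
    define e where "e = (r * x\<^sup>2 + r * y\<^sup>2 - (1 + r\<^sup>2) * x * y) / (1 - r\<^sup>2)\<^sup>2 - r / (1 - r\<^sup>2)"
    \<comment> \<open>\<open>e\<close> is the derivative of \<open>E\<close>, and \<open>gam_1_1\<close> says that the logarithmic derivative of \<open>\<gamma>\<^sub>0\<^sub>,\<^sub>0\<close> is \<open>- e\<close>\<close>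
    define N where "N r = r\<^sup>2 * x\<^sup>2 - 2 * r * x * y + r\<^sup>2 * y\<^sup>2" for r :: real
    define D where "D r = 2 * (1 - r\<^sup>2)" for r :: real
    have N': "(N has_real_derivative (2 * r * x\<^sup>2 - 2 * x * y + 2 * r * y\<^sup>2)) (at r)"
      unfolding N_def by (auto intro!: derivative_eq_intros)
    have D': "(D has_real_derivative (- 4 * r)) (at r)"
      unfolding D_def by (auto intro!: derivative_eq_intros)
    have D0: "D r \<noteq> 0" using p by (simp add: D_def)
    have "((2 * r * x\<^sup>2 - 2 * x * y + 2 * r * y\<^sup>2) * D r - N r * (- 4 * r)) =
        4 * (r * x\<^sup>2 + r * y\<^sup>2 - (1 + r\<^sup>2) * x * y)"
      by (simp add: D_def N_def algebra_simps power2_eq_square)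
    moreover have "D r * D r = 4 * (1 - r\<^sup>2)\<^sup>2" by (simp add: D_def power2_eq_square algebra_simps)
    ultimately have quotient: "((2 * r * x\<^sup>2 - 2 * x * y + 2 * r * y\<^sup>2) * D r - N r * (- 4 * r)) / (D r * D r) =
        (r * x\<^sup>2 + r * y\<^sup>2 - (1 + r\<^sup>2) * x * y) / (1 - r\<^sup>2)\<^sup>2"
      by (simp only: mult_divide_mult_cancel_left_if) simp
    have ND: "((\<lambda>r. N r / D r) has_real_derivative
        (r * x\<^sup>2 + r * y\<^sup>2 - (1 + r\<^sup>2) * x * y) / (1 - r\<^sup>2)\<^sup>2) (at r)"
      using DERIV_divide[OF N' D' D0] unfolding quotient .
    have "((\<lambda>r. ln (1 - r\<^sup>2) / 2) has_real_derivative - (r / (1 - r\<^sup>2))) (at r)"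
      using p by (auto intro!: derivative_eq_intros simp: field_simps)
    from DERIV_add[OF ND this] have "(E has_real_derivative e) (at r)"
      by (simp add: E_def[abs_def] e_def N_def D_def)
    then have D2: "((\<lambda>r. exp (E r)) has_real_derivative exp (E r) * e) (at r)"
      by (rule DERIV_fun_exp)
    have "(1 - r\<^sup>2)\<^sup>2 * gam 1 1 1 x y r =
        (y * (x - r * y) * (1 - r\<^sup>2) - r * ((x - r * y)\<^sup>2 - (1 - r\<^sup>2))) * gam 1 0 0 x y r"
      using gam_1_1[OF q xy r] by (simp add: power2_eq_square)
    also have "\<dots> = - (1 - r\<^sup>2)\<^sup>2 * e * gam 1 0 0 x y r"
    proof -
      have "(1 - r\<^sup>2)\<^sup>2 * e = r * x\<^sup>2 + r * y\<^sup>2 - (1 + r\<^sup>2) * x * y - r * (1 - r\<^sup>2)"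
      proof -
        have "P\<^sup>2 * (X / P\<^sup>2 - r / P) = X - r * P" if "P \<noteq> 0" for P X :: real
          using that by (simp add: right_diff_distrib power2_eq_square)
        from this[of "1 - r\<^sup>2"] show ?thesis using p by (simp add: e_def)
      qed
      then have "y * (x - r * y) * (1 - r\<^sup>2) - r * ((x - r * y)\<^sup>2 - (1 - r\<^sup>2)) = - (1 - r\<^sup>2)\<^sup>2 * e"
        by (simp add: power2_eq_square algebra_simps)
      then show ?thesis by (simp only:)
    qed
    finally have "(1 - r\<^sup>2)\<^sup>2 * gam 1 1 1 x y r = (1 - r\<^sup>2)\<^sup>2 * (- e * gam 1 0 0 x y r)"
      by simp
    then have "gam 1 1 1 x y r = - e * gam 1 0 0 x y r"
      using p by (subst (asm) mult_cancel_left) simp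
    with DERIV_mult[OF G' D2] show ?thesis by (simp add: algebra_simps)
  qed
  have "gam 1 0 0 x y \<rho> * exp (E \<rho>) = gam 1 0 0 x y 0 * exp (E 0)"
    by (rule DERIV_isconst3[of "-1" 1]) (use \<rho> deriv in auto)
  also have "gam 1 0 0 x y 0 = 1" unfolding gam_powser powser_zero by simp
  finally have "gam 1 0 0 x y \<rho> = exp (- E \<rho>)"
    by (simp add: E_def exp_minus field_simps)
  also have "\<dots> = exp (- (\<rho>\<^sup>2 * x\<^sup>2 - 2 * \<rho> * x * y + \<rho>\<^sup>2 * y\<^sup>2) / (2 * (1 - \<rho>\<^sup>2))) / exp (ln (1 - \<rho>\<^sup>2) / 2)"
    unfolding exp_diff[symmetric] E_def
    by (simp only: minus_divide_left minus_add_distrib diff_conv_add_uminus)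
  also have "exp (ln (1 - \<rho>\<^sup>2) / 2) = sqrt (1 - \<rho>\<^sup>2)"
  proof -
    have "1 - \<rho>\<^sup>2 > 0" using \<rho> by (simp add: abs_square_less_1)
    then have "ln (1 - \<rho>\<^sup>2) / 2 = ln (sqrt (1 - \<rho>\<^sup>2))" "sqrt (1 - \<rho>\<^sup>2) > 0"
      by (simp_all only: ln_sqrt real_sqrt_gt_0_iff)
    then show ?thesis by (simp only: exp_ln)
  qed
  finally show ?thesis .
qed

lemma gam_nonzero:
  assumes "-1 < q" "q \<le> 1" "x \<in> S q" "y \<in> S q" "\<bar>\<rho>\<bar> < 1"
  shows "gam q 0 0 x y \<rho> \<noteq> 0"
proof (cases "q = 1")
  case True
  then show ?thesis using assms by (simp add: Mehler abs_square_eq_1)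
next
  case False
  then show ?thesis using assms by (intro gam_nonzero_inside) auto
qed

lemma f_CN_eq_gam:
  assumes "-1 < q" "q \<le> 1" "x \<in> S q" "y \<in> S q" "\<bar>\<rho>\<bar> < 1"
  shows "f_CN q x y \<rho> = f_N q x * gam q 0 0 x y \<rho>"
proof (cases "q = 1")
  case True
  have p: "1 - \<rho>\<^sup>2 > 0" using assms by (simp add: abs_square_less_1)
  have "- (x - \<rho> * y)\<^sup>2 / (2 * (1 - \<rho>\<^sup>2)) =
      - x\<^sup>2 / 2 + - (\<rho>\<^sup>2 * x\<^sup>2 - 2 * \<rho> * x * y + \<rho>\<^sup>2 * y\<^sup>2) / (2 * (1 - \<rho>\<^sup>2))"
    using p by (simp add: field_simps power2_eq_square)
  then show ?thesis using True assms
    by (simp add: f_CN_def f_N_def Mehler real_sqrt_mult flip: exp_add)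
next
  case False
  then show ?thesis using assms by (simp add: f_CN_def mult.assoc Poisson_Mehler_q)
qed

section \<open>Inverse linearization\<close>

text \<open>For \<open>|q| < 1\<close> these are the coefficients of the power series \<open>\<Prod>\<^sub>i (1 - (1 - q) z q\<^sup>i)\<close>, the reciprocal
  of the q-exponential \<open>\<Sum>\<^sub>n z\<^sup>n / [n]!\<close>.\<close>

definition lin_coeff :: "real \<Rightarrow> nat \<Rightarrow> real" where
  "lin_coeff q l = (- 1) ^ l * q ^ (l * (l - 1) div 2) / qfact q l"

lemma divide_out: "c * u = w \<Longrightarrow> 0 < c \<Longrightarrow> u = w / (c::real)"
  by (simp add: eq_divide_eq mult.commute)

lemma sums_divide_out:
  fixes k :: real
  assumes "(\<lambda>n. k * f n) sums T" "k \<noteq> 0"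
  shows "f sums (T / k)"
  using sums_divide[OF assms(1), of k] assms(2) by simp

lemma lin_coeff_0 [simp]: "lin_coeff q 0 = 1"
  by (simp add: lin_coeff_def)

lemma lin_coeff_Suc:
  assumes "-1 < q" "q \<le> 1"
  shows "lin_coeff q (Suc l) * qint q (Suc l) = - (q ^ l) * lin_coeff q l"
proof -
  have "Suc l * l div 2 = l + l * (l - 1) div 2"
    by (cases l) (simp_all add: algebra_simps)
  then show ?thesis
    using qint_pos[OF assms, of "Suc l"]
    by (simp add: lin_coeff_def qfact_Suc power_add)
qed

lemma abs_lin_coeff_le:
  assumes "-1 < q" "q \<le> 1"
  shows "\<bar>lin_coeff q l\<bar> \<le> 1 / qfact q l"
proof -
  have "\<bar>q\<bar> ^ (l * (l - 1) div 2) \<le> 1" using assms by (intro power_le_one) auto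
  then show ?thesis using qfact_pos[OF assms, of l]
    by (simp add: lin_coeff_def abs_mult power_abs divide_right_mono)
qed

text \<open>Splitting \<open>[s + 1] = [s + 1 - l] + q\<^bsup>s+1-l\<^esup> [l]\<close> in \<open>[s + 1] W\<^sub>s\<^sub>+\<^sub>1\<close>, where \<open>W\<^sub>s\<close> is the left-hand
  side: the first part is \<open>y W\<^sub>s\<close> and the second, after a shift of \<open>l\<close>, is \<open>- q\<^sup>s z W\<^sub>s\<close>.\<close>

lemma q_binomial_theorem:
  assumes q: "-1 < q" "q \<le> 1"
  shows "(\<Sum>l\<le>s. lin_coeff q l * z ^ l * y ^ (s - l) / qfact q (s - l)) = qpoch_hom q y z s / qfact q s"
proof (induction s)
  case (Suc s)
  define W where "W s = (\<Sum>l\<le>s. lin_coeff q l * z ^ l * y ^ (s - l) / qfact q (s - l))" for s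
  define c where "c l = lin_coeff q l * z ^ l * y ^ (Suc s - l) / qfact q (Suc s - l)" for l
  have "qint q (Suc s) * W (Suc s) = (\<Sum>l\<le>Suc s. qint q (Suc s - l) * c l + q ^ (Suc s - l) * qint q l * c l)"
    unfolding W_def sum_distrib_left c_def
  proof (rule sum.cong)
    fix l assume "l \<in> {..Suc s}"
    then have "qint q (Suc s) = qint q (Suc s - l) + q ^ (Suc s - l) * qint q l"
      using qint_add[of q "Suc s - l" l] by simp
    then show "qint q (Suc s) * (lin_coeff q l * z ^ l * y ^ (Suc s - l) / qfact q (Suc s - l)) =
        qint q (Suc s - l) * (lin_coeff q l * z ^ l * y ^ (Suc s - l) / qfact q (Suc s - l)) +
        q ^ (Suc s - l) * qint q l * (lin_coeff q l * z ^ l * y ^ (Suc s - l) / qfact q (Suc s - l))"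
      by (simp only: distrib_right)
  qed simp
  also have "\<dots> = (\<Sum>l\<le>Suc s. qint q (Suc s - l) * c l) + (\<Sum>l\<le>Suc s. q ^ (Suc s - l) * qint q l * c l)"
    by (rule sum.distrib)
  also have "(\<Sum>l\<le>Suc s. qint q (Suc s - l) * c l) = (\<Sum>l\<le>s. qint q (Suc s - l) * c l)"
    by simp
  also have "\<dots> = y * W s"
    unfolding W_def sum_distrib_left
  proof (rule sum.cong)
    fix l assume "l \<in> {..s}"
    then have "Suc s - l = Suc (s - l)" by auto
    then show "qint q (Suc s - l) * c l = y * (lin_coeff q l * z ^ l * y ^ (s - l) / qfact q (s - l))"
      using qint_pos[OF q, of "Suc (s - l)"] qfact_pos[OF q, of "s - l"]
      by (simp add: c_def qfact_Suc)
  qed simp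
  also have "(\<Sum>l\<le>Suc s. q ^ (Suc s - l) * qint q l * c l) = (\<Sum>l\<le>s. q ^ (s - l) * qint q (Suc l) * c (Suc l))"
    by (subst sum.atMost_Suc_shift) simp
  also have "\<dots> = - (q ^ s) * z * W s"
    unfolding W_def sum_distrib_left
  proof (rule sum.cong)
    fix l assume l: "l \<in> {..s}"
    have "q ^ (s - l) * qint q (Suc l) * c (Suc l) =
        q ^ (s - l) * (lin_coeff q (Suc l) * qint q (Suc l)) * z * z ^ l * y ^ (s - l) / qfact q (s - l)"
      by (simp add: c_def mult_ac)
    also have "q ^ (s - l) * (lin_coeff q (Suc l) * qint q (Suc l)) = - (q ^ (s - l) * q ^ l) * lin_coeff q l"
      by (simp add: lin_coeff_Suc[OF q])
    also have "q ^ (s - l) * q ^ l = q ^ s" using l by (simp flip: power_add)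
    finally show "q ^ (s - l) * qint q (Suc l) * c (Suc l) =
        - (q ^ s) * z * (lin_coeff q l * z ^ l * y ^ (s - l) / qfact q (s - l))" by (simp add: mult_ac)
  qed simp
  also have "y * W s + - (q ^ s) * z * W s = (y - z * q ^ s) * W s" by (simp add: algebra_simps)
  also have "W s = qpoch_hom q y z s / qfact q s" using Suc by (simp add: W_def)
  finally have "qint q (Suc s) * W (Suc s) = qpoch_hom q y z (Suc s) / qfact q s"
    by (simp add: qpoch_hom_def)
  then have "W (Suc s) = qpoch_hom q y z (Suc s) / qfact q s / qint q (Suc s)"
    by (rule divide_out) (use qint_pos[OF q, of "Suc s"] in simp)
  then show ?case unfolding W_def by (simp add: qfact_Suc mult.commute)
qed (simp add: qpoch_hom_def)

text \<open>Integer indices with the value \<open>0\<close> below zero make the recurrence for \<open>H\<^sub>n / [n]!\<close> and the sums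
  of \<open>inv_lin\<close> free of boundary cases.\<close>

definition norm_Hermite :: "real \<Rightarrow> real \<Rightarrow> int \<Rightarrow> real" where
  "norm_Hermite q x n = (if n < 0 then 0 else qHermite q (nat n) x / qfact q (nat n))"

lemma norm_Hermite_Suc:
  assumes q: "-1 < q" "q \<le> 1"
  shows "qint q (Suc n) * norm_Hermite q x (int (Suc n)) =
     x * norm_Hermite q x (int n) - norm_Hermite q x (int n - 1)"
proof -
  have "qint q (Suc n) * norm_Hermite q x (int (Suc n)) = qHermite q (Suc n) x / qfact q n"
    using qint_pos[OF q, of "Suc n"] by (simp add: norm_Hermite_def qfact_Suc nat_add_distrib del: of_nat_Suc)
  moreover have "qint q n * qHermite q (n - 1) x / qfact q n = norm_Hermite q x (int n - 1)"
    using qint_pos[OF q, of n] by (cases n) (simp_all add: norm_Hermite_def qfact_Suc)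
  ultimately show ?thesis
    by (simp add: qHermite_Suc diff_divide_distrib norm_Hermite_def)
qed

lemma norm_Hermite_split:
  assumes q: "-1 < q" "q \<le> 1"
  shows "qint q (Suc i) * norm_Hermite q x (int (Suc i) - int l) =
     x * norm_Hermite q x (int i - int l) - norm_Hermite q x (int i - 1 - int l)
       + q ^ (Suc i - l) * qint q l * norm_Hermite q x (int (Suc i) - int l)"
proof (cases "l \<le> i")
  case True
  then obtain n where i: "i = l + n" using le_Suc_ex by blast
  have "qint q (Suc i) = qint q (Suc n) + q ^ Suc n * qint q l"
    using qint_add[of q "Suc n" l] by (simp add: i add.commute)
  moreover have "int (Suc i) - int l = int (Suc n)" "int i - int l = int n" "int i - 1 - int l = int n - 1"
    "Suc i - l = Suc n" by (simp_all add: i)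
  ultimately show ?thesis
    using norm_Hermite_Suc[OF q, of n x] by (simp only: distrib_right)
next
  case False
  then show ?thesis by (cases "l = Suc i") (auto simp: norm_Hermite_def)
qed

definition inv_lin :: "real \<Rightarrow> real \<Rightarrow> int \<Rightarrow> nat \<Rightarrow> real" where
  "inv_lin q x i k = (\<Sum>l\<le>k. lin_coeff q l * norm_Hermite q x (i - int l) * norm_Hermite q x (int k - int l))"

text \<open>The same splitting of \<open>[i + 1]\<close> as in the q-binomial theorem, now with the three-term recurrence
  for the first part.\<close>

lemma inv_lin_Suc:
  assumes q: "-1 < q" "q \<le> 1"
  shows "qint q (Suc i) * inv_lin q x (int (Suc i)) k =
    x * inv_lin q x (int i) k - inv_lin q x (int i - 1) k
      - (if k = 0 then 0 else q ^ i * inv_lin q x (int i) (k - 1))"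
proof -
  define E where "E = norm_Hermite q x"
  define r where "r l = lin_coeff q l * q ^ (Suc i - l) * qint q l * E (int (Suc i) - int l) * E (int k - int l)"
    for l
  have "qint q (Suc i) * inv_lin q x (int (Suc i)) k =
      (\<Sum>l\<le>k. lin_coeff q l * (qint q (Suc i) * E (int (Suc i) - int l)) * E (int k - int l))"
    unfolding inv_lin_def sum_distrib_left E_def by (simp add: mult_ac)
  also have "\<dots> = (\<Sum>l\<le>k. x * (lin_coeff q l * E (int i - int l) * E (int k - int l))
      - lin_coeff q l * E (int i - 1 - int l) * E (int k - int l) + r l)"
    unfolding E_def norm_Hermite_split[OF q] r_def by (simp add: algebra_simps)
  also have "\<dots> = x * inv_lin q x (int i) k - inv_lin q x (int i - 1) k + (\<Sum>l\<le>k. r l)"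
    by (simp add: sum.distrib sum_subtractf inv_lin_def E_def sum_distrib_left)
  also have "(\<Sum>l\<le>k. r l) = - (if k = 0 then 0 else q ^ i * inv_lin q x (int i) (k - 1))"
  proof (cases k)
    case 0
    then show ?thesis by (simp add: r_def)
  next
    case (Suc k')
    have "r (Suc l) = - (q ^ i * (lin_coeff q l * E (int i - int l) * E (int k' - int l)))" for l
    proof -
      have "r (Suc l) = (lin_coeff q (Suc l) * qint q (Suc l)) * q ^ (i - l) * E (int i - int l) * E (int k' - int l)"
        by (simp add: r_def Suc)
      also have "\<dots> = - (q ^ (i - l) * q ^ l * E (int i - int l)) * lin_coeff q l * E (int k' - int l)"
        by (simp add: lin_coeff_Suc[OF q])
      also have "q ^ (i - l) * q ^ l * E (int i - int l) = q ^ i * E (int i - int l)"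
        by (cases "l \<le> i") (simp_all add: E_def norm_Hermite_def flip: power_add)
      finally show ?thesis by simp
    qed
    moreover have "(\<Sum>l\<le>k. r l) = (\<Sum>l\<le>k'. r (Suc l))"
      unfolding Suc by (subst sum.atMost_Suc_shift) (simp add: r_def)
    ultimately show ?thesis using Suc
      by (simp add: inv_lin_def E_def sum_negf sum_distrib_left)
  qed
  finally show ?thesis by simp
qed

text \<open>Both sides satisfy the same recurrence in \<open>i\<close>: for the right-hand side it is the recurrence of
  \<open>H\<^sub>i\<^sub>+\<^sub>k\<^sub>+\<^sub>1\<close> with \<open>[i + k] = [i] + q\<^sup>i [k]\<close>.\<close>

lemma inv_lin_eq:
  assumes q: "-1 < q" "q \<le> 1"
  shows "inv_lin q x (int i) k = qHermite q (i + k) x / (qfact q i * qfact q k)"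
proof (induction i arbitrary: k rule: less_induct)
  case (less i)
  show ?case
  proof (cases i)
    case 0
    have "inv_lin q x 0 k = (\<Sum>l\<le>k. if l = 0 then qHermite q k x / qfact q k else 0)"
      unfolding inv_lin_def by (rule sum.cong) (auto simp: norm_Hermite_def)
    then show ?thesis using 0 by simp
  next
    case (Suc n)
    have 1: "inv_lin q x (int n) k' = qHermite q (n + k') x / (qfact q n * qfact q k')" for k'
      using less[of n] Suc by simp
    have 2: "inv_lin q x (int n - 1) k = qint q n * qHermite q (n - 1 + k) x / (qfact q n * qfact q k)"
    proof (cases n)
      case 0
      then show ?thesis by (simp add: inv_lin_def norm_Hermite_def)
    next
      case (Suc m)
      then show ?thesis using less[of m] \<open>i = Suc n\<close> qint_pos[OF q, of "Suc m"]
        by (simp add: qfact_Suc)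
    qed
    have 3: "(if k = 0 then 0 else q ^ n * inv_lin q x (int n) (k - 1)) =
        q ^ n * qint q k * qHermite q (n + k - 1) x / (qfact q n * qfact q k)"
      using qint_pos[OF q, of k] by (cases k) (simp_all add: 1 qfact_Suc)
    have 4: "qint q n * qHermite q (n - 1 + k) x = qint q n * qHermite q (n + k - 1) x"
      by (cases n) simp_all
    have "qint q (Suc n) * inv_lin q x (int (Suc n)) k =
        (x * qHermite q (n + k) x - (qint q n + q ^ n * qint q k) * qHermite q (n + k - 1) x)
          / (qfact q n * qfact q k)"
      unfolding inv_lin_Suc[OF q] 1[of k] 2 3 4
      by (simp only: diff_divide_distrib[symmetric] times_divide_eq_right distrib_right diff_diff_eq mult.assoc)
    also have "\<dots> = qHermite q (Suc n + k) x / (qfact q n * qfact q k)"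
      using qHermite_Suc[of q "n + k" x] by (simp add: qint_add)
    finally have "inv_lin q x (int (Suc n)) k = qHermite q (Suc n + k) x / (qfact q n * qfact q k) / qint q (Suc n)"
      by (rule divide_out) (use qint_pos[OF q, of "Suc n"] in simp)
    then show ?thesis unfolding Suc by (simp add: qfact_Suc mult_ac)
  qed
qed

text \<open>The inverse of the linearization formula for \<open>H\<^sub>i H\<^sub>k\<close>.  It separates the indices \<open>i\<close> and \<open>k\<close>,
  which are coupled in the triple series through \<open>H\<^sub>i\<^sub>+\<^sub>k(x\<^sub>3)\<close>.\<close>

lemma inverse_linearization:
  assumes q: "-1 < q" "q \<le> 1"
  shows "qHermite q (i + k) x / (qfact q i * qfact q k) =
    (\<Sum>l\<le>min i k. lin_coeff q l * (qHermite q (i - l) x / qfact q (i - l))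
        * (qHermite q (k - l) x / qfact q (k - l)))"
proof -
  have "inv_lin q x (int i) k = (\<Sum>l\<le>min i k. lin_coeff q l * norm_Hermite q x (int i - int l)
      * norm_Hermite q x (int k - int l))"
    unfolding inv_lin_def by (rule sum.mono_neutral_right) (auto simp: norm_Hermite_def)
  also have "\<dots> = (\<Sum>l\<le>min i k. lin_coeff q l * (qHermite q (i - l) x / qfact q (i - l))
        * (qHermite q (k - l) x / qfact q (k - l)))"
    by (rule sum.cong) (auto simp: norm_Hermite_def simp flip: of_nat_diff)
  finally show ?thesis by (simp add: inv_lin_eq[OF q])
qed

section \<open>Rearranging the triple series\<close>

definition triple_term :: "real \<Rightarrow> real \<Rightarrow> real \<Rightarrow> real \<Rightarrow> real \<Rightarrow> real \<Rightarrow> real \<Rightarrow> nat \<times> nat \<times> nat \<Rightarrow> real" where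
  "triple_term q x1 x2 x3 \<rho>12 \<rho>13 \<rho>23 = (\<lambda>(i, j, k).
     \<rho>12 ^ j * \<rho>23 ^ k * \<rho>13 ^ i / (qfact q i * qfact q j * qfact q k)
       * qHermite q (i + j) x1 * qHermite q (j + k) x2 * qHermite q (i + k) x3)"

lemma summable_on_Times_nonneg:
  fixes f :: "'a \<Rightarrow> real" and g :: "'b \<Rightarrow> real"
  assumes "f summable_on UNIV" "g summable_on UNIV" "\<And>a. f a \<ge> 0" "\<And>b. g b \<ge> 0"
  shows "(\<lambda>(a, b). f a * g b) summable_on UNIV"
proof -
  have "(\<lambda>(a, b). f a * g b) summable_on Sigma UNIV (\<lambda>_. UNIV)"
  proof (rule summable_on_SigmaI)
    show "((\<lambda>b. case (a, b) of (a, b) \<Rightarrow> f a * g b) has_sum (f a * infsum g UNIV)) UNIV" for a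
      using assms(2) by (simp add: has_sum_cmult_right)
    show "(\<lambda>a. f a * infsum g UNIV) summable_on UNIV"
      using assms(1) by (rule summable_on_cmult_left)
  qed (use assms in auto)
  then show ?thesis by simp
qed

lemma geometric_summable_on:
  fixes r :: real
  assumes "0 \<le> r" "r < 1"
  shows "(\<lambda>n. r ^ n) summable_on UNIV"
  using assms by (intro norm_summable_imp_summable_on) (simp add: summable_geometric)

lemma has_sum_diagonal:
  fixes f :: "nat \<times> nat \<Rightarrow> real"
  assumes "(f has_sum a) UNIV"
  shows "(\<lambda>s. \<Sum>l\<le>s. f (l, s - l)) sums a"
proof -
  have "((\<lambda>(s, l). f (l, s - l)) has_sum a) (Sigma UNIV (\<lambda>s. {..s}))"
    by (subst has_sum_reindex_bij_witness[where i = "\<lambda>(l, j). (l + j, l)" and j = "\<lambda>(s, l). (l, s - l)"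
          and T = UNIV and h = f and s' = a]) (use assms in auto)
  then have "((\<lambda>s. \<Sum>l\<le>s. f (l, s - l)) has_sum a) UNIV"
    by (rule has_sum_SigmaD) (simp add: has_sum_finite)
  then show ?thesis by (rule has_sum_imp_sums)
qed

context
  fixes q x1 x2 x3 \<rho>12 \<rho>13 \<rho>23 :: real
  assumes q: "\<bar>q\<bar> < 1" and x: "x1 \<in> S q" "x2 \<in> S q" "x3 \<in> S q"
    and \<rho>: "\<bar>\<rho>12\<bar> < 1" "\<bar>\<rho>13\<bar> < 1" "\<bar>\<rho>23\<bar> < 1"
begin

private lemma q_range: "-1 < q" "q \<le> 1" using q by auto

text \<open>The triple series after inverse linearization of \<open>H\<^sub>i\<^sub>+\<^sub>k(x\<^sub>3)\<close>, with \<open>i\<close> and \<open>k\<close> replaced by \<open>i + l\<close> and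
  \<open>k + l\<close>.  The nesting of the pairs is the order in which the indices are summed in
  \<open>triple_sums_ASC\<close>: first \<open>k\<close>, then \<open>i\<close>, and last \<open>(l, j)\<close>.\<close>

private definition quad :: "((nat \<times> nat) \<times> nat) \<times> nat \<Rightarrow> real" where
  "quad = (\<lambda>(((l, j), i), k). lin_coeff q l * (\<rho>12 ^ j / qfact q j) * \<rho>13 ^ (i + l) * \<rho>23 ^ (k + l)
     * qHermite q (i + l + j) x1 * qHermite q (k + l + j) x2
     * (qHermite q i x3 / qfact q i) * (qHermite q k x3 / qfact q k))"

text \<open>Each of the four indices contributes a factor of at most \<open>M u\<^sup>2 v = M R < 1\<close>, where \<open>M\<close> bounds
  the three correlations.  For \<open>l\<close>, which carries two correlations, one of them is estimated by \<open>1\<close>.\<close>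

private lemma quad_summable: "quad summable_on UNIV"
proof -
  define M where "M = max \<bar>\<rho>12\<bar> (max \<bar>\<rho>13\<bar> \<bar>\<rho>23\<bar>)"
  have M: "0 \<le> M" "M < 1" "\<bar>\<rho>12\<bar> \<le> M" "\<bar>\<rho>13\<bar> \<le> M" "\<bar>\<rho>23\<bar> \<le> M"
    using \<rho> by (auto simp: M_def)
  define R where "R = 2 / (1 + M)"
  have R: "R > 1" "M * R < 1" using M by (simp_all add: R_def field_simps)
  from growth_rates[OF q R(1)] obtain u v where uv: "u > 0" "v > 0" "u * u * v = R"
    and H: "\<And>x. x \<in> S q \<Longrightarrow> \<exists>K>0. \<forall>n. \<bar>qHermite q n x\<bar> \<le> K * u ^ n"
    and F: "\<exists>K>0. \<forall>n. 1 / qfact q n \<le> K * v ^ n" by metis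
  obtain K1 where K1: "K1 > 0" "\<And>n. \<bar>qHermite q n x1\<bar> \<le> K1 * u ^ n" using H[OF x(1)] by auto
  obtain K2 where K2: "K2 > 0" "\<And>n. \<bar>qHermite q n x2\<bar> \<le> K2 * u ^ n" using H[OF x(2)] by auto
  obtain K3 where K3: "K3 > 0" "\<And>n. \<bar>qHermite q n x3\<bar> \<le> K3 * u ^ n" using H[OF x(3)] by auto
  obtain K where K: "K > 0" "\<And>n. 1 / qfact q n \<le> K * v ^ n" using F by auto
  define r where "r = M * R"
  have r: "0 \<le> r" "r < 1" using M R by (auto simp: r_def)
  define B where "B = (\<lambda>(((l, j), i), k). r ^ l * r ^ j * r ^ i * r ^ k)"
  define P where "P = K * K * K * K * K1 * K2 * K3 * K3"
  have "B summable_on UNIV"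
  proof -
    have 1: "(\<lambda>n. r ^ n) summable_on UNIV" using r by (rule geometric_summable_on)
    have 2: "(\<lambda>(l, j). r ^ l * r ^ j) summable_on UNIV"
      using r by (intro summable_on_Times_nonneg 1) auto
    have 3: "(\<lambda>(a, i). (case a of (l, j) \<Rightarrow> r ^ l * r ^ j) * r ^ i) summable_on UNIV"
      using r by (intro summable_on_Times_nonneg 1 2) auto
    have "(\<lambda>(b, k). (case b of (a, i) \<Rightarrow> (case a of (l, j) \<Rightarrow> r ^ l * r ^ j) * r ^ i) * r ^ k) summable_on UNIV"
      using r by (intro summable_on_Times_nonneg 1 3) auto
    also have "(\<lambda>(b, k). (case b of (a, i) \<Rightarrow> (case a of (l, j) \<Rightarrow> r ^ l * r ^ j) * r ^ i) * r ^ k) = B"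
      by (auto simp: B_def)
    finally show ?thesis .
  qed
  then have PB: "(\<lambda>z. P * B z) summable_on UNIV" by (rule summable_on_cmult_right)
  have "norm (quad (((l, j), i), k)) \<le> P * B (((l, j), i), k)" for l j i k
  proof -
    have inv: "\<bar>1 / qfact q n\<bar> \<le> K * v ^ n" for n using K(2)[of n] qfact_pos[OF q_range, of n] by simp
    have lc: "\<bar>lin_coeff q l\<bar> \<le> K * v ^ l"
      using abs_lin_coeff_le[OF q_range, of l] K(2)[of l] by linarith
    have step: "\<bar>\<rho>12\<bar> ^ j * \<bar>1 / qfact q j\<bar> \<le> M ^ j * (K * v ^ j)"
      by (intro mult_mono' inv power_mono M) simp_all
    have \<rho>13: "\<bar>\<rho>13\<bar> ^ (i + l) \<le> M ^ (i + l)" by (intro power_mono M) simp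
    have "\<bar>\<rho>23\<bar> ^ (k + l) \<le> \<bar>\<rho>23\<bar> ^ k"
      using \<rho> by (intro power_decreasing) auto
    also have "\<dots> \<le> M ^ k" by (intro power_mono M) simp
    finally have \<rho>23: "\<bar>\<rho>23\<bar> ^ (k + l) \<le> M ^ k" .
    have H3: "\<bar>qHermite q n x3\<bar> * \<bar>1 / qfact q n\<bar> \<le> K3 * u ^ n * (K * v ^ n)" for n
      by (intro mult_mono' inv K3(2)) simp_all
    have "norm (quad (((l, j), i), k)) = \<bar>lin_coeff q l\<bar> * (\<bar>\<rho>12\<bar> ^ j * \<bar>1 / qfact q j\<bar>)
        * \<bar>\<rho>13\<bar> ^ (i + l) * \<bar>\<rho>23\<bar> ^ (k + l) * \<bar>qHermite q (i + l + j) x1\<bar> * \<bar>qHermite q (k + l + j) x2\<bar>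
        * (\<bar>qHermite q i x3\<bar> * \<bar>1 / qfact q i\<bar>) * (\<bar>qHermite q k x3\<bar> * \<bar>1 / qfact q k\<bar>)"
      by (simp add: quad_def abs_mult power_abs)
    also have "\<dots> \<le> (K * v ^ l) * (M ^ j * (K * v ^ j)) * M ^ (i + l) * M ^ k
        * (K1 * u ^ (i + l + j)) * (K2 * u ^ (k + l + j))
        * (K3 * u ^ i * (K * v ^ i)) * (K3 * u ^ k * (K * v ^ k))"
      by (intro mult_mono' lc step \<rho>13 \<rho>23 K1(2) K2(2) H3) simp_all
    also have "\<dots> = P * B (((l, j), i), k)"
      by (simp add: B_def P_def r_def uv(3)[symmetric] power_mult_distrib power_add mult_ac)
    finally show ?thesis .
  qed
  then have "norm (quad z) \<le> P * B z" for z by (cases z, cases "fst z", cases "fst (fst z)") auto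
  then have "(\<lambda>z. norm (quad z)) summable_on UNIV"
    by (rule Infinite_Sum.abs_summable_on_comparison_test'[OF PB])
  then show ?thesis by (rule summable_on_iff_abs_summable_on_real[THEN iffD2])
qed

private lemma gam_has_sum:
  assumes "y \<in> S q" "z \<in> S q" "\<bar>r\<bar> < 1"
  shows "(gam_term q m k y z r has_sum gam q m k y z r) UNIV"
  by (intro norm_summable_imp_has_sum summable_norm_gam_term gam_term_sums q_range assms)

text \<open>Summing the quadruple series over \<open>l\<close> first undoes the inverse linearization.  This also yields
  the summability of the triple series.\<close>

private lemma quad_triple:
  assumes "(quad has_sum a) UNIV"
  shows "(triple_term q x1 x2 x3 \<rho>12 \<rho>13 \<rho>23 has_sum a) UNIV"
proof -
  define f where "f = (\<lambda>((i, j, k), l). quad (((l, j), i - l), k - l))"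
  have "(f has_sum a) (Sigma UNIV (\<lambda>(i, j, k). {..min i k}))"
    by (subst has_sum_reindex_bij_witness[where i = "\<lambda>(((l, j), i), k). ((i + l, j, k + l), l)"
          and j = "\<lambda>((i, j, k), l). (((l, j), i - l), k - l)" and T = UNIV and h = quad and s' = a])
       (use assms in \<open>auto simp: f_def\<close>)
  then show ?thesis
  proof (rule has_sum_SigmaD)
    fix t :: "nat \<times> nat \<times> nat"
    obtain i j k where t: "t = (i, j, k)" by (cases t)
    have "(\<Sum>l\<le>min i k. f (t, l)) = (\<rho>12 ^ j / qfact q j) * \<rho>13 ^ i * \<rho>23 ^ k
        * qHermite q (i + j) x1 * qHermite q (k + j) x2 * (\<Sum>l\<le>min i k. lin_coeff q l *
          (qHermite q (i - l) x3 / qfact q (i - l)) * (qHermite q (k - l) x3 / qfact q (k - l)))"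
      unfolding sum_distrib_left by (rule sum.cong) (auto simp: f_def t quad_def mult_ac)
    also have "\<dots> = triple_term q x1 x2 x3 \<rho>12 \<rho>13 \<rho>23 t"
      unfolding inverse_linearization[OF q_range, symmetric]
      by (simp add: triple_term_def t add.commute[of k j] mult_ac)
    finally have "(\<Sum>l\<le>min i k. f (t, l)) = triple_term q x1 x2 x3 \<rho>12 \<rho>13 \<rho>23 t" .
    then show "((\<lambda>l. f (t, l)) has_sum triple_term q x1 x2 x3 \<rho>12 \<rho>13 \<rho>23 t) (case t of (i, j, k) \<Rightarrow> {..min i k})"
      unfolding t by (auto intro!: has_sum_finiteI)
  qed
qed

lemma triple_has_sum:
  "(triple_term q x1 x2 x3 \<rho>12 \<rho>13 \<rho>23 has_sum infsum (triple_term q x1 x2 x3 \<rho>12 \<rho>13 \<rho>23) UNIV) UNIV"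
  using quad_triple[OF has_sum_infsum[OF quad_summable]] by (metis infsumI)

lemma triple_sums_ASC:
  "(\<lambda>s. qpoch_hom q \<rho>12 (\<rho>13 * \<rho>23) s / (qfact q s * qpoch2 q (\<rho>13\<^sup>2) (\<rho>23\<^sup>2) s)
      * ASC q s x1 x3 \<rho>13 * ASC q s x2 x3 \<rho>23)
   sums (infsum (triple_term q x1 x2 x3 \<rho>12 \<rho>13 \<rho>23) UNIV / (gam q 0 0 x1 x3 \<rho>13 * gam q 0 0 x2 x3 \<rho>23))"
proof -
  define T where "T = infsum (triple_term q x1 x2 x3 \<rho>12 \<rho>13 \<rho>23) UNIV"
  define c where "c l j = lin_coeff q l * (\<rho>12 ^ j / qfact q j) * (\<rho>13 * \<rho>23) ^ l" for l j
  define g where "g m y r = gam q m 0 y x3 r" for m y r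
  have "(quad has_sum T) UNIV"
    using quad_triple[OF has_sum_infsum[OF quad_summable]] has_sum_infsum[OF quad_summable]
    unfolding T_def by (metis infsumI)
  then have "(quad has_sum T) (Sigma UNIV (\<lambda>_. UNIV))" by simp
  then have "((\<lambda>((l, j), i). c l j * g (l + j) x2 \<rho>23 * gam_term q (l + j) 0 x1 x3 \<rho>13 i) has_sum T) UNIV"
  proof (rule has_sum_SigmaD)
    fix t :: "(nat \<times> nat) \<times> nat"
    obtain l j i where t: "t = ((l, j), i)" by (metis surj_pair)
    have "((\<lambda>k. c l j * gam_term q (l + j) 0 x1 x3 \<rho>13 i * gam_term q (l + j) 0 x2 x3 \<rho>23 k) has_sum
      c l j * gam_term q (l + j) 0 x1 x3 \<rho>13 i * g (l + j) x2 \<rho>23) UNIV"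
      unfolding g_def by (intro has_sum_cmult_right gam_has_sum x \<rho>)
    then show "((\<lambda>k. quad (t, k)) has_sum (\<lambda>((l, j), i).
        c l j * g (l + j) x2 \<rho>23 * gam_term q (l + j) 0 x1 x3 \<rho>13 i) t) UNIV"
      by (simp add: t quad_def c_def gam_term_def power_add power_mult_distrib mult_ac add.assoc)
  qed
  then have "((\<lambda>((l, j), i). c l j * g (l + j) x2 \<rho>23 * gam_term q (l + j) 0 x1 x3 \<rho>13 i) has_sum T) (Sigma UNIV (\<lambda>_. UNIV))"
    by simp
  then have "((\<lambda>(l, j). c l j * g (l + j) x2 \<rho>23 * g (l + j) x1 \<rho>13) has_sum T) UNIV"
  proof (rule has_sum_SigmaD)
    fix t :: "nat \<times> nat"
    show "((\<lambda>i. (\<lambda>((l, j), i). c l j * g (l + j) x2 \<rho>23 * gam_term q (l + j) 0 x1 x3 \<rho>13 i) (t, i))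
        has_sum (case t of (l, j) \<Rightarrow> c l j * g (l + j) x2 \<rho>23 * g (l + j) x1 \<rho>13)) UNIV"
      unfolding g_def by (cases t) (auto intro!: has_sum_cmult_right gam_has_sum x \<rho>)
  qed
  from has_sum_diagonal[OF this]
  have "(\<lambda>s. \<Sum>l\<le>s. c l (s - l) * g s x2 \<rho>23 * g s x1 \<rho>13) sums T" by simp
  also have "(\<lambda>s. \<Sum>l\<le>s. c l (s - l) * g s x2 \<rho>23 * g s x1 \<rho>13) = (\<lambda>s. (g 0 x1 \<rho>13 * g 0 x2 \<rho>23) *
      (qpoch_hom q \<rho>12 (\<rho>13 * \<rho>23) s / (qfact q s * qpoch2 q (\<rho>13\<^sup>2) (\<rho>23\<^sup>2) s)
      * ASC q s x1 x3 \<rho>13 * ASC q s x2 x3 \<rho>23))"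
  proof
    fix s
    have "(\<Sum>l\<le>s. c l (s - l) * g s x2 \<rho>23 * g s x1 \<rho>13) =
        (\<Sum>l\<le>s. lin_coeff q l * (\<rho>13 * \<rho>23) ^ l * \<rho>12 ^ (s - l) / qfact q (s - l)) * g s x2 \<rho>23 * g s x1 \<rho>13"
      unfolding sum_distrib_right by (rule sum.cong) (auto simp: c_def)
    also have "\<dots> = qpoch_hom q \<rho>12 (\<rho>13 * \<rho>23) s / qfact q s * g s x2 \<rho>23 * g s x1 \<rho>13"
      by (simp only: q_binomial_theorem[OF q_range])
    also have "\<dots> = (g 0 x1 \<rho>13 * g 0 x2 \<rho>23) *
      (qpoch_hom q \<rho>12 (\<rho>13 * \<rho>23) s / (qfact q s * qpoch2 q (\<rho>13\<^sup>2) (\<rho>23\<^sup>2) s)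
      * ASC q s x1 x3 \<rho>13 * ASC q s x2 x3 \<rho>23)"
      unfolding g_def gam_ASC[OF q_range x(1,3) \<rho>(2), of s] gam_ASC[OF q_range x(2,3) \<rho>(3), of s]
      by (simp add: qpoch2_def mult_ac)
    finally show "(\<Sum>l\<le>s. c l (s - l) * g s x2 \<rho>23 * g s x1 \<rho>13) = (g 0 x1 \<rho>13 * g 0 x2 \<rho>23) *
      (qpoch_hom q \<rho>12 (\<rho>13 * \<rho>23) s / (qfact q s * qpoch2 q (\<rho>13\<^sup>2) (\<rho>23\<^sup>2) s)
      * ASC q s x1 x3 \<rho>13 * ASC q s x2 x3 \<rho>23)" .
  qed
  finally have "\<dots> sums T" .
  moreover have "g 0 x1 \<rho>13 * g 0 x2 \<rho>23 \<noteq> 0"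
    unfolding g_def using gam_nonzero[OF q_range] x \<rho> by simp
  ultimately show ?thesis unfolding T_def g_def by (rule sums_divide_out)
qed

lemma triple_sums_C:
  "(\<lambda>s. 1 / qfact q s * qHermite q s x2 * C q s x1 x3 \<rho>12 \<rho>23 \<rho>13)
   sums (infsum (triple_term q x1 x2 x3 \<rho>12 \<rho>13 \<rho>23) UNIV / gam q 0 0 x1 x3 \<rho>13)"
proof -
  define T where "T = infsum (triple_term q x1 x2 x3 \<rho>12 \<rho>13 \<rho>23) UNIV"
  define c where "c k j = \<rho>12 ^ j * \<rho>23 ^ k / (qfact q j * qfact q k) * qHermite q (k + j) x2" for j k
  define g where "g m k = gam q m k x1 x3 \<rho>13" for m k
  have "((\<lambda>((k, j), i). triple_term q x1 x2 x3 \<rho>12 \<rho>13 \<rho>23 (i, j, k)) has_sum T) UNIV"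
    by (subst has_sum_reindex_bij_witness[where i = "\<lambda>(i, j, k). ((k, j), i)"
          and j = "\<lambda>((k, j), i). (i, j, k)" and T = UNIV
          and h = "triple_term q x1 x2 x3 \<rho>12 \<rho>13 \<rho>23" and s' = T])
       (use triple_has_sum in \<open>auto simp: T_def\<close>)
  then have "((\<lambda>((k, j), i). triple_term q x1 x2 x3 \<rho>12 \<rho>13 \<rho>23 (i, j, k)) has_sum T) (Sigma UNIV (\<lambda>_. UNIV))"
    by simp
  then have "((\<lambda>(k, j). c k j * g j k) has_sum T) UNIV"
  proof (rule has_sum_SigmaD)
    fix t :: "nat \<times> nat"
    obtain k j where t: "t = (k, j)" by (cases t)
    have "((\<lambda>i. c k j * gam_term q j k x1 x3 \<rho>13 i) has_sum (c k j * g j k)) UNIV"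
      unfolding g_def by (intro has_sum_cmult_right gam_has_sum x \<rho>)
    then show "((\<lambda>i. (\<lambda>((k, j), i). triple_term q x1 x2 x3 \<rho>12 \<rho>13 \<rho>23 (i, j, k)) (t, i))
        has_sum (case t of (k, j) \<Rightarrow> c k j * g j k)) UNIV"
      by (simp add: t triple_term_def c_def gam_term_def mult_ac add.commute)
  qed
  from has_sum_diagonal[OF this] have "(\<lambda>s. \<Sum>k\<le>s. c k (s - k) * g (s - k) k) sums T" by simp
  moreover have nz: "g 0 0 \<noteq> 0"
    unfolding g_def using gam_nonzero[OF q_range] x \<rho> by simp
  moreover have "(\<Sum>k\<le>s. c k (s - k) * g (s - k) k) =
      g 0 0 * (1 / qfact q s * qHermite q s x2 * C q s x1 x3 \<rho>12 \<rho>23 \<rho>13)" for s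
    unfolding C_def sum_distrib_left atLeast0AtMost
  proof (rule sum.cong)
    fix k assume "k \<in> {..s}"
    then have c: "c k (s - k) = (qbinomial q s k / qfact q s) * \<rho>12 ^ (s - k) * \<rho>23 ^ k * qHermite q s x2"
      using qfact_pos[OF q_range, of s] by (simp add: c_def qbinomial_def mult.commute)
    have "g (s - k) k = g 0 0 * Q q (s - k) k x1 x3 \<rho>13"
      using nz by (simp add: Q_def g_def)
    then show "c k (s - k) * g (s - k) k = g 0 0 * (1 / qfact q s * qHermite q s x2 *
        (qbinomial q s k * \<rho>12 ^ (s - k) * \<rho>23 ^ k * Q q (s - k) k x1 x3 \<rho>13))"
      unfolding c by simp
  qed simp
  ultimately have "(\<lambda>s. g 0 0 * (1 / qfact q s * qHermite q s x2 * C q s x1 x3 \<rho>12 \<rho>23 \<rho>13)) sums T"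
    by simp
  then show ?thesis using nz unfolding T_def g_def by (rule sums_divide_out)
qed

end

section \<open>The Gaussian case\<close>

lemma Mehler_sums:
  assumes "\<bar>r\<bar> < 1"
  shows "(\<lambda>n. r ^ n / fact n * qHermite 1 n u * qHermite 1 n v) sums
     (exp (- (r\<^sup>2 * u\<^sup>2 - 2 * r * u * v + r\<^sup>2 * v\<^sup>2) / (2 * (1 - r\<^sup>2))) / sqrt (1 - r\<^sup>2))"
  using gam_term_sums[of 1 u v r 0 0] assms
  by (simp add: Mehler S_def gam_term_def[abs_def] qfact_one)

text \<open>Both \<open>P\<^sub>n\<close> and \<open>C\<^sub>n\<close> have this form for \<open>q = 1\<close>.\<close>

lemma scaled_Hermite:
  fixes p :: "nat \<Rightarrow> real"
  assumes "p 0 = 1" "\<And>n. p (Suc n) = m * p n - \<sigma>\<^sup>2 * n * p (n - 1)" "\<sigma> \<noteq> 0"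
  shows "p n = \<sigma> ^ n * qHermite 1 n (m / \<sigma>)"
proof (induction n rule: less_induct)
  case (less n)
  show ?case
  proof (cases n)
    case (Suc k)
    have "real k * p (k - 1) * \<sigma> = real k * (\<sigma> ^ k * qHermite 1 (k - 1) (m / \<sigma>))"
      using less[of "k - 1"] Suc by (cases k) (simp_all add: mult_ac del: of_nat_Suc)
    then have "\<sigma>\<^sup>2 * k * p (k - 1) = \<sigma> * \<sigma> ^ k * (real k * qHermite 1 (k - 1) (m / \<sigma>))"
      by (simp add: power2_eq_square mult_ac)
    moreover have "m * p k = \<sigma> * \<sigma> ^ k * (m / \<sigma> * qHermite 1 k (m / \<sigma>))"
      using less[of k] Suc assms(3) by simp
    ultimately show ?thesis unfolding Suc assms(2) qHermite_Suc
      by (simp add: right_diff_distrib)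
  qed (use assms in simp)
qed

text \<open>Mehler's formula with correlation \<open>\<surd>V\<close>, in a form that avoids \<open>m / \<surd>V\<close> and therefore covers
  the degenerate case \<open>V = m = 0\<close>, where only the term \<open>n = 0\<close> survives.\<close>

lemma Mehler_sums_recurrence:
  fixes p :: "nat \<Rightarrow> real"
  assumes V: "0 \<le> V" "V < 1" and m: "V = 0 \<Longrightarrow> m = 0"
    and p: "p 0 = 1" "\<And>n. p (Suc n) = m * p n - V * n * p (n - 1)"
  shows "(\<lambda>n. 1 / fact n * qHermite 1 n x * p n) sums
     (exp (- (V * x\<^sup>2 - 2 * m * x + m\<^sup>2) / (2 * (1 - V))) / sqrt (1 - V))"
proof (cases "V = 0")
  case True
  then have "p n = 0" if "n \<noteq> 0" for n using p(2)[of "n - 1"] m that by simp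
  then have "(\<lambda>n. 1 / fact n * qHermite 1 n x * p n) sums (\<Sum>n\<in>{0}. 1 / fact n * qHermite 1 n x * p n)"
    by (intro sums_finite) auto
  then show ?thesis using True m p by simp
next
  case False
  define \<sigma> where "\<sigma> = sqrt V"
  have \<sigma>: "\<sigma>\<^sup>2 = V" "\<sigma> \<noteq> 0" "\<bar>\<sigma>\<bar> < 1" using V False by (auto simp: \<sigma>_def)
  have "p n = \<sigma> ^ n * qHermite 1 n (m / \<sigma>)" for n
    by (rule scaled_Hermite) (use p \<sigma> False in auto)
  then have terms: "(\<lambda>n. 1 / fact n * qHermite 1 n x * p n) = (\<lambda>n. \<sigma> ^ n / fact n * qHermite 1 n x * qHermite 1 n (m / \<sigma>))"
    by (simp add: mult_ac)
  have "V * (m / \<sigma>)\<^sup>2 = m\<^sup>2" using False by (simp add: power_divide \<sigma>(1))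
  then have exponent: "V * x\<^sup>2 - 2 * \<sigma> * x * (m / \<sigma>) + V * (m / \<sigma>)\<^sup>2 = V * x\<^sup>2 - 2 * m * x + m\<^sup>2"
    using \<sigma>(2) by simp
  show ?thesis
    using Mehler_sums[OF \<sigma>(3), of x "m / \<sigma>"] unfolding \<sigma>(1) exponent terms .
qed

text \<open>Up to the factor \<open>\<gamma>\<^sub>0\<^sub>,\<^sub>0\<close>, this is \<open>C\<^sub>n\<close> at \<open>q = 1\<close> for \<open>f m k = \<rho>\<^sub>1\<^sup>m \<rho>\<^sub>2\<^sup>k \<gamma>\<^sub>m\<^sub>,\<^sub>k\<close>.  On exponential
  generating functions it restricts a function of two variables to the diagonal, so raising an index acts as a derivative (Leibniz rule)
  and lowering it with the factor \<open>m\<close> or \<open>k\<close> acts as multiplication by the variable.\<close>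

definition binomial_sum :: "(nat \<Rightarrow> nat \<Rightarrow> real) \<Rightarrow> nat \<Rightarrow> real" where
  "binomial_sum f n = (\<Sum>i\<le>n. real (n choose i) * f (n - i) i)"

lemma binomial_sum_Suc:
  "binomial_sum f (Suc n) = binomial_sum (\<lambda>m k. f (Suc m) k + f m (Suc k)) n"
proof -
  have "(\<Sum>i\<le>n. real (n choose i) * f (Suc (n - i)) i) = (\<Sum>i\<le>n. real (n choose i) * f (Suc n - i) i)"
    by (rule sum.cong) (auto simp: Suc_diff_le)
  also have "\<dots> = (\<Sum>i\<le>Suc n. real (n choose i) * f (Suc n - i) i)" by simp
  also have "\<dots> = f (Suc n) 0 + (\<Sum>i\<le>n. real (n choose Suc i) * f (n - i) (Suc i))"
    by (subst sum.atMost_Suc_shift) simp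
  finally show ?thesis
    unfolding binomial_sum_def sum.atMost_Suc_shift
    by (simp add: distrib_left distrib_right sum.distrib)
qed

lemma binomial_sum_absorb_left:
  "binomial_sum (\<lambda>m k. real m * f (m - 1) k) n = real n * binomial_sum f (n - 1)"
proof (cases n)
  case (Suc n')
  have "binomial_sum (\<lambda>m k. real m * f (m - 1) k) n = (\<Sum>i\<le>n'. real ((n - i) * (n choose i)) * f (n' - i) i)"
    unfolding binomial_sum_def Suc by (simp add: mult_ac)
  also have "(n - i) * (n choose i) = n * (n' choose i)" for i
    using binomial_absorb_comp[of n i] by (simp add: Suc)
  then have "(\<Sum>i\<le>n'. real ((n - i) * (n choose i)) * f (n' - i) i) = real n * binomial_sum f n'"
    unfolding binomial_sum_def sum_distrib_left by (simp only: of_nat_mult mult.assoc)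
  finally show ?thesis by (simp add: Suc)
qed (simp add: binomial_sum_def)

lemma binomial_sum_absorb_right:
  "binomial_sum (\<lambda>m k. real k * f m (k - 1)) n = real n * binomial_sum f (n - 1)"
proof (cases n)
  case (Suc n')
  have "binomial_sum (\<lambda>m k. real k * f m (k - 1)) n =
      (\<Sum>i\<le>n'. real (Suc i * (Suc n' choose Suc i)) * f (n' - i) i)"
    unfolding binomial_sum_def Suc sum.atMost_Suc_shift
    by (simp add: mult_ac del: of_nat_Suc binomial_Suc_Suc mult_Suc)
  also have "Suc i * (Suc n' choose Suc i) = n * (n' choose i)" for i
    using Suc_times_binomial_eq[of n' i] by (simp only: Suc mult.commute)
  then have "(\<Sum>i\<le>n'. real (Suc i * (Suc n' choose Suc i)) * f (n' - i) i) = real n * binomial_sum f n'"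
    unfolding binomial_sum_def sum_distrib_left by (simp only: of_nat_mult mult.assoc)
  finally show ?thesis by (simp add: Suc)
qed (simp add: binomial_sum_def)

lemma binomial_sum_linear:
  "binomial_sum (\<lambda>m k. a * f m k + b * g m k + c * h m k) n =
     a * binomial_sum f n + b * binomial_sum g n + c * binomial_sum h n"
  by (simp add: binomial_sum_def sum.distrib sum_distrib_left algebra_simps)

context
  fixes x y \<rho> \<rho>1 \<rho>2 :: real
  assumes \<rho>: "\<bar>\<rho>\<bar> < 1"
begin

text \<open>Solving the two relations between \<open>\<gamma>\<^sub>m\<^sub>+\<^sub>1\<^sub>,\<^sub>k\<close> and \<open>\<gamma>\<^sub>m\<^sub>,\<^sub>k\<^sub>+\<^sub>1\<close> gives each of them through
  \<open>\<gamma>\<^sub>m\<^sub>,\<^sub>k\<close>, \<open>\<gamma>\<^sub>m\<^sub>-\<^sub>1\<^sub>,\<^sub>k\<close>, \<open>\<gamma>\<^sub>m\<^sub>,\<^sub>k\<^sub>-\<^sub>1\<close>; the absorption identities collect the lower terms into \<open>n C\<^sub>n\<^sub>-\<^sub>1\<close>.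
  Divided by \<open>1 - \<rho>\<^sup>2\<close>, the coefficients are the conditional mean of the third variable given
  \<open>x\<close> and \<open>y\<close>, and the squared multiple correlation.\<close>

lemma C_one_recurrence:
  "(1 - \<rho>\<^sup>2) * C 1 (Suc n) x y \<rho>1 \<rho>2 \<rho> = (\<rho>1 * (x - \<rho> * y) + \<rho>2 * (y - \<rho> * x)) * C 1 n x y \<rho>1 \<rho>2 \<rho>
     - (\<rho>1\<^sup>2 + \<rho>2\<^sup>2 - 2 * \<rho>1 * \<rho>2 * \<rho>) * n * C 1 (n - 1) x y \<rho>1 \<rho>2 \<rho>"
proof -
  define g where "g m k = gam 1 m k x y \<rho>" for m k
  define f where "f m k = \<rho>1 ^ m * \<rho>2 ^ k * g m k" for m k
  define A where "A = \<rho>1 * (x - \<rho> * y) + \<rho>2 * (y - \<rho> * x)"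
  have C: "C 1 n x y \<rho>1 \<rho>2 \<rho> = binomial_sum f n / g 0 0" for n
    unfolding C_def binomial_sum_def sum_divide_distrib atLeast0AtMost
    by (rule sum.cong) (auto simp: qbinomial_def qfact_one Q_def f_def g_def binomial_fact)
  have xy: "x \<in> S 1" "y \<in> S 1" by (auto simp: S_def)
  have left: "g (Suc m) k = x * g m k - m * g (m - 1) k - \<rho> * g m (Suc k)" for m k
    using gam_Suc_left[of 1 x y \<rho> m k] xy \<rho> by (simp add: g_def)
  have right: "g m (Suc k) = y * g m k - k * g m (k - 1) - \<rho> * g (Suc m) k" for m k
    using gam_Suc_right[of 1 x y \<rho> m k] xy \<rho> by (simp add: g_def)
  have solve_left: "(1 - \<rho>\<^sup>2) * g (Suc m) k = (x - \<rho> * y) * g m k - m * g (m - 1) k + \<rho> * (k * g m (k - 1))" for m k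
    using left[of m k] right[of m k] by (simp add: power2_eq_square algebra_simps)
  have solve_right: "(1 - \<rho>\<^sup>2) * g m (Suc k) = (y - \<rho> * x) * g m k - k * g m (k - 1) + \<rho> * (m * g (m - 1) k)" for m k
    using right[of m k] arg_cong[OF left[of m k], of "\<lambda>t. \<rho> * t"] by (simp add: power2_eq_square algebra_simps)
  have ml: "\<rho>1 ^ m * \<rho>2 ^ k * (m * g (m - 1) k) = \<rho>1 * (m * f (m - 1) k)" for m k
    by (cases m) (simp_all add: f_def)
  have mr: "\<rho>1 ^ m * \<rho>2 ^ k * (k * g m (k - 1)) = \<rho>2 * (k * f m (k - 1))" for m k
    by (cases k) (simp_all add: f_def)
  have step: "(1 - \<rho>\<^sup>2) * (f (Suc m) k + f m (Suc k)) = A * f m k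
      + (- (\<rho>1 - \<rho> * \<rho>2) * \<rho>1) * (m * f (m - 1) k) + (- (\<rho>2 - \<rho> * \<rho>1) * \<rho>2) * (k * f m (k - 1))" for m k
  proof -
    have "(1 - \<rho>\<^sup>2) * (f (Suc m) k + f m (Suc k)) = \<rho>1 ^ m * \<rho>2 ^ k *
        (\<rho>1 * ((1 - \<rho>\<^sup>2) * g (Suc m) k) + \<rho>2 * ((1 - \<rho>\<^sup>2) * g m (Suc k)))"
      by (simp add: f_def algebra_simps)
    also have "\<dots> = A * f m k - (\<rho>1 - \<rho> * \<rho>2) * (\<rho>1 ^ m * \<rho>2 ^ k * (m * g (m - 1) k))
         - (\<rho>2 - \<rho> * \<rho>1) * (\<rho>1 ^ m * \<rho>2 ^ k * (k * g m (k - 1)))"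
      unfolding solve_left solve_right by (simp add: A_def f_def algebra_simps)
    finally show ?thesis unfolding ml mr by (simp add: algebra_simps)
  qed
  have "(1 - \<rho>\<^sup>2) * binomial_sum f (Suc n) = binomial_sum (\<lambda>m k. (1 - \<rho>\<^sup>2) * (f (Suc m) k + f m (Suc k))) n"
    unfolding binomial_sum_Suc by (simp add: binomial_sum_def sum_distrib_left mult_ac)
  also have "\<dots> = A * binomial_sum f n + (- (\<rho>1 - \<rho> * \<rho>2) * \<rho>1) * (n * binomial_sum f (n - 1))
      + (- (\<rho>2 - \<rho> * \<rho>1) * \<rho>2) * (n * binomial_sum f (n - 1))"
    unfolding step binomial_sum_linear binomial_sum_absorb_left binomial_sum_absorb_right ..
  also have "\<dots> = A * binomial_sum f n - (\<rho>1\<^sup>2 + \<rho>2\<^sup>2 - 2 * \<rho>1 * \<rho>2 * \<rho>) * n * binomial_sum f (n - 1)"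
    by (simp add: algebra_simps power2_eq_square)
  finally show ?thesis unfolding C A_def
    by (simp only: times_divide_eq_right diff_divide_distrib)
qed

lemma C_one_0: "C 1 0 x y \<rho>1 \<rho>2 \<rho> = 1"
  using gam_nonzero[of 1 x y \<rho>] \<rho> by (simp add: C_def Q_def qbinomial_def S_def)

end

lemma correlation_positivity:
  fixes a b c :: real
  assumes "\<bar>b\<bar> < 1"
  shows "a\<^sup>2 + c\<^sup>2 - 2 * a * c * b \<ge> 0" and "a\<^sup>2 + c\<^sup>2 - 2 * a * c * b = 0 \<Longrightarrow> a = 0 \<and> c = 0"
proof -
  have b: "1 - b\<^sup>2 > 0" using assms by (simp add: abs_square_less_1)
  have eq: "a\<^sup>2 + c\<^sup>2 - 2 * a * c * b = (a - b * c)\<^sup>2 + (1 - b\<^sup>2) * c\<^sup>2"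
    by (simp add: power2_eq_square algebra_simps)
  show "a\<^sup>2 + c\<^sup>2 - 2 * a * c * b \<ge> 0" unfolding eq using b by simp
  assume "a\<^sup>2 + c\<^sup>2 - 2 * a * c * b = 0"
  then have "(a - b * c)\<^sup>2 + (1 - b\<^sup>2) * c\<^sup>2 = 0" unfolding eq .
  then have "(a - b * c)\<^sup>2 = 0 \<and> (1 - b\<^sup>2) * c\<^sup>2 = 0"
    using b by (subst (asm) add_nonneg_eq_0_iff) auto
  then show "a = 0 \<and> c = 0" using b by auto
qed

text \<open>The determinant of the correlation matrix, and the quadratic form of its adjugate.\<close>

definition corr_det :: "real \<Rightarrow> real \<Rightarrow> real \<Rightarrow> real" where
  "corr_det a b c = 1 + 2 * a * b * c - a\<^sup>2 - b\<^sup>2 - c\<^sup>2"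

definition corr_form :: "real \<Rightarrow> real \<Rightarrow> real \<Rightarrow> real \<Rightarrow> real \<Rightarrow> real \<Rightarrow> real" where
  "corr_form a b c x1 x2 x3 = (1 - c\<^sup>2) * x1\<^sup>2 + (1 - b\<^sup>2) * x2\<^sup>2 + (1 - a\<^sup>2) * x3\<^sup>2
     - 2 * (a - b * c) * x1 * x2 - 2 * (b - a * c) * x1 * x3 - 2 * (c - a * b) * x2 * x3"

lemma det_corr_matrix: "det (corr_matrix a b c) = corr_det a b c"
  by (simp add: corr_matrix_def det_3 vector_3 corr_det_def power2_eq_square algebra_simps)

text \<open>Instead of inverting the matrix, the proof exhibits the solution \<open>z\<close> of \<open>R z = x\<close> (Cramer's
  rule) and evaluates \<open>x \<bullet> z\<close>.\<close>

lemma gaussian_density_corr_matrix: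
  assumes D: "corr_det a b c > 0"
  shows "gaussian_density (corr_matrix a b c) (vector [x1, x2, x3]) =
     exp (- corr_form a b c x1 x2 x3 / (2 * corr_det a b c)) / sqrt ((2 * pi) ^ 3 * corr_det a b c)"
proof -
  define R where "R = corr_matrix a b c"
  define x :: "real^3" where "x = vector [x1, x2, x3]"
  define D where "D = corr_det a b c"
  have D0: "D \<noteq> 0" using assms by (simp add: D_def)
  define z :: "real^3" where "z = vector [
    ((1 - c\<^sup>2) * x1 - (a - b * c) * x2 - (b - a * c) * x3) / D,
    ((1 - b\<^sup>2) * x2 - (a - b * c) * x1 - (c - a * b) * x3) / D,
    ((1 - a\<^sup>2) * x3 - (b - a * c) * x1 - (c - a * b) * x2) / D]"
  have "R *v z = x"
    unfolding vec_eq_iff forall_3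
    using D0 by (simp add: R_def x_def z_def corr_matrix_def matrix_vector_mult_def sum_3 field_simps)
       (simp add: D_def corr_det_def power2_eq_square algebra_simps)
  moreover have "invertible R"
    using D0 by (simp add: invertible_det_nz R_def det_corr_matrix D_def)
  then have "matrix_inv R ** R = mat 1"
    unfolding invertible_def matrix_inv_def by (rule someI2_ex) simp
  ultimately have "matrix_inv R *v x = z"
    by (metis matrix_vector_mul_assoc matrix_vector_mul_lid)
  moreover have "x \<bullet> z = corr_form a b c x1 x2 x3 / D"
    using D0 by (simp add: x_def z_def inner_vec_def sum_3 corr_form_def field_simps power2_eq_square)
  ultimately show ?thesis
    by (simp add: gaussian_density_def R_def[symmetric] x_def[symmetric])
       (simp add: R_def det_corr_matrix D_def)
qed

lemma exponent_split:
  fixes g d \<alpha> p \<beta> t \<gamma> z y :: real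
  assumes "g / d = \<alpha> / p + \<beta> / t + \<gamma> + z / y"
  shows "- g / (2 * d) = - \<alpha> / (2 * p) + - \<beta> / (2 * t) + - \<gamma> / 2 + - z / (2 * y)"
proof -
  have "- g / (2 * d) = - (1 / 2) * (g / d)" by simp
  also have "\<dots> = - \<alpha> / (2 * p) + - \<beta> / (2 * t) + - \<gamma> / 2 + - z / (2 * y)"
    unfolding assms distrib_left by simp
  finally show ?thesis .
qed

context
  fixes a b c x1 x2 x3 :: real
  assumes abc: "\<bar>a\<bar> < 1" "\<bar>b\<bar> < 1" "\<bar>c\<bar> < 1" and D: "corr_det a b c > 0"
begin

text \<open>The density of \<open>X\<^sub>2\<close> given \<open>X\<^sub>1, X\<^sub>3\<close> divided by \<open>f\<^sub>N(x\<^sub>2)\<close> is a Mehler kernel: \<open>m / p\<close> is the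
  conditional mean, \<open>v / p\<close> the squared multiple correlation, and \<open>d = p - v\<close>.\<close>

lemma gaussian_sums_C:
  obtains s where "(\<lambda>n. 1 / fact n * qHermite 1 n x2 * C 1 n x1 x3 a c b) sums s"
    "gaussian_density (corr_matrix a b c) (vector [x1, x2, x3]) = f_CN 1 x3 x1 b * f_N 1 x1 * f_N 1 x2 * s"
proof -
  define p where "p = 1 - b\<^sup>2"
  define v where "v = a\<^sup>2 + c\<^sup>2 - 2 * a * c * b"
  define m where "m = a * (x1 - b * x3) + c * (x3 - b * x1)"
  define d where "d = corr_det a b c"
  have p: "p > 0" using abc by (simp add: p_def abs_square_less_1)
  have d: "d > 0" "d = p - v" using D by (simp_all add: d_def p_def v_def corr_det_def algebra_simps)
  have v: "v \<ge> 0" "v = 0 \<Longrightarrow> m = 0"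
    using correlation_positivity[OF abc(2), of a c] by (auto simp: v_def m_def)
  have "(\<lambda>n. 1 / fact n * qHermite 1 n x2 * C 1 n x1 x3 a c b) sums
      (exp (- (v / p * x2\<^sup>2 - 2 * (m / p) * x2 + (m / p)\<^sup>2) / (2 * (1 - v / p))) / sqrt (1 - v / p))"
  proof (rule Mehler_sums_recurrence)
    fix n
    have "p * C 1 (Suc n) x1 x3 a c b = m * C 1 n x1 x3 a c b - v * n * C 1 (n - 1) x1 x3 a c b"
      using C_one_recurrence[OF abc(2), of n x1 x3 a c] by (simp add: p_def v_def m_def)
    then have "C 1 (Suc n) x1 x3 a c b = (m * C 1 n x1 x3 a c b - v * n * C 1 (n - 1) x1 x3 a c b) / p"
      using p by (simp add: field_simps)
    then show "C 1 (Suc n) x1 x3 a c b = m / p * C 1 n x1 x3 a c b - v / p * n * C 1 (n - 1) x1 x3 a c b"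
      by (simp add: diff_divide_distrib)
  qed (use p v d C_one_0[OF abc(2)] in \<open>auto simp: field_simps\<close>)
  moreover have "gaussian_density (corr_matrix a b c) (vector [x1, x2, x3]) =
      f_CN 1 x3 x1 b * f_N 1 x1 * f_N 1 x2 *
      (exp (- (v / p * x2\<^sup>2 - 2 * (m / p) * x2 + (m / p)\<^sup>2) / (2 * (1 - v / p))) / sqrt (1 - v / p))"
  proof -
    have dp: "1 - v / p = d / p" using d p by (simp add: field_simps)
    \<comment> \<open>the identity of quadratic forms behind the factorization of the density\<close>
    define z where "z = p * v * x2\<^sup>2 - 2 * p * m * x2 + m\<^sup>2"
    have form: "p * corr_form a b c x1 x2 x3 = d * ((x3 - b * x1)\<^sup>2 + p * x1\<^sup>2 + p * x2\<^sup>2) + z"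
      unfolding d(2) z_def by (simp add: corr_form_def p_def v_def m_def power2_eq_square algebra_simps)
    have "corr_form a b c x1 x2 x3 / d = (p * corr_form a b c x1 x2 x3) / (p * d)"
      using p by simp
    also have "\<dots> = (x3 - b * x1)\<^sup>2 / p + x1\<^sup>2 + x2\<^sup>2 + z / (p * d)"
      unfolding form using p d(1) by (simp add: add_divide_distrib)
    also have "z / (p * d) = (p * v * x2\<^sup>2 - 2 * p * m * x2 + m\<^sup>2) / (p * d)"
      by (simp only: z_def)
    also have "(p * v * x2\<^sup>2 - 2 * p * m * x2 + m\<^sup>2) / (p * d) =
        (v / p * x2\<^sup>2 - 2 * (m / p) * x2 + (m / p)\<^sup>2) / (d / p)"
      using p d(1) by (simp add: field_simps power2_eq_square)
    finally have "corr_form a b c x1 x2 x3 / d = (x3 - b * x1)\<^sup>2 / p + x1\<^sup>2 / 1 + x2\<^sup>2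
        + (v / p * x2\<^sup>2 - 2 * (m / p) * x2 + (m / p)\<^sup>2) / (d / p)"
      by (simp only: div_by_1)
    from exponent_split[OF this]
    have E: "- corr_form a b c x1 x2 x3 / (2 * d) = - (x3 - b * x1)\<^sup>2 / (2 * p) + - x1\<^sup>2 / 2
        + - x2\<^sup>2 / 2 + - (v / p * x2\<^sup>2 - 2 * (m / p) * x2 + (m / p)\<^sup>2) / (2 * (d / p))"
      by (simp only: mult_1_right)
    have "(2 * pi) ^ 3 * d = (2 * pi * p) * (2 * pi) * (2 * pi) * (d / p)"
      using p by (simp add: power3_eq_cube)
    then have "sqrt ((2 * pi) ^ 3 * d) = sqrt (2 * pi * p) * sqrt (2 * pi) * sqrt (2 * pi) * sqrt (d / p)"
      by (simp only: real_sqrt_mult)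
    then show ?thesis
      unfolding gaussian_density_corr_matrix[OF D] d_def[symmetric] E exp_add dp
      by (simp add: f_CN_def f_N_def p_def)
  qed
  ultimately show ?thesis by (rule that)
qed

text \<open>Given \<open>X\<^sub>3\<close>, the standardized residuals \<open>u\<close> and \<open>w\<close> of \<open>X\<^sub>1\<close> and \<open>X\<^sub>2\<close> are jointly Gaussian with the
  partial correlation \<open>r\<close>, and \<open>d = p t (1 - r\<^sup>2)\<close>.\<close>

lemma gaussian_sums_ASC:
  obtains s where "(\<lambda>n. qpoch_hom 1 a (b * c) n / (fact n * qpoch2 1 (b\<^sup>2) (c\<^sup>2) n)
      * ASC 1 n x1 x3 b * ASC 1 n x2 x3 c) sums s"
    "gaussian_density (corr_matrix a b c) (vector [x1, x2, x3]) = f_CN 1 x1 x3 b * f_CN 1 x3 x2 c * f_N 1 x2 * s"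
proof -
  define p where "p = 1 - b\<^sup>2"
  define t where "t = 1 - c\<^sup>2"
  define e where "e = a - b * c"
  define A where "A = x1 - b * x3"
  define B where "B = x2 - c * x3"
  define d where "d = corr_det a b c"
  have p: "p > 0" using abc by (simp add: p_def abs_square_less_1)
  have t: "t > 0" using abc by (simp add: t_def abs_square_less_1)
  have d: "d > 0" "d = p * t - e\<^sup>2"
    using D by (simp_all add: d_def p_def t_def e_def corr_det_def power2_eq_square algebra_simps)
  define r where "r = e / (sqrt p * sqrt t)"
  define u where "u = A / sqrt p"
  define w where "w = B / sqrt t"
  have r2: "r\<^sup>2 = e\<^sup>2 / (p * t)" using p t by (simp add: r_def power_divide power_mult_distrib)
  then have dr: "1 - r\<^sup>2 = d / (p * t)" using d p t by (simp add: field_simps)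
  then have "1 - r\<^sup>2 > 0" using d p t by simp
  then have "\<bar>r\<bar> < 1" by (simp add: abs_square_less_1)
  note Mehler_sums[OF this, of u w]
  moreover have "r ^ n / fact n * qHermite 1 n u * qHermite 1 n w =
      qpoch_hom 1 a (b * c) n / (fact n * qpoch2 1 (b\<^sup>2) (c\<^sup>2) n) * ASC 1 n x1 x3 b * ASC 1 n x2 x3 c" for n
  proof -
    have "ASC 1 n x1 x3 b = sqrt p ^ n * qHermite 1 n (A / sqrt p)"
      by (rule scaled_Hermite) (use p in \<open>auto simp: ASC_Suc A_def p_def\<close>)
    moreover have "ASC 1 n x2 x3 c = sqrt t ^ n * qHermite 1 n (B / sqrt t)"
      by (rule scaled_Hermite) (use t in \<open>auto simp: ASC_Suc B_def t_def\<close>)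
    moreover have "qpoch_hom 1 a (b * c) n / (fact n * qpoch2 1 (b\<^sup>2) (c\<^sup>2) n) = e ^ n / (fact n * (p ^ n * t ^ n))"
      by (simp add: qpoch_hom_def qpoch2_def qpoch_def p_def t_def e_def)
    moreover have "p ^ n = sqrt p ^ n * sqrt p ^ n" "t ^ n = sqrt t ^ n * sqrt t ^ n"
      using p t by (simp_all flip: power_mult_distrib)
    ultimately show ?thesis using p t
      by (simp add: r_def u_def w_def power_divide power_mult_distrib mult_ac)
  qed
  ultimately have "(\<lambda>n. qpoch_hom 1 a (b * c) n / (fact n * qpoch2 1 (b\<^sup>2) (c\<^sup>2) n)
      * ASC 1 n x1 x3 b * ASC 1 n x2 x3 c) sums
      (exp (- (r\<^sup>2 * u\<^sup>2 - 2 * r * u * w + r\<^sup>2 * w\<^sup>2) / (2 * (1 - r\<^sup>2))) / sqrt (1 - r\<^sup>2))"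
    by simp
  moreover have "gaussian_density (corr_matrix a b c) (vector [x1, x2, x3]) =
      f_CN 1 x1 x3 b * f_CN 1 x3 x2 c * f_N 1 x2 *
      (exp (- (r\<^sup>2 * u\<^sup>2 - 2 * r * u * w + r\<^sup>2 * w\<^sup>2) / (2 * (1 - r\<^sup>2))) / sqrt (1 - r\<^sup>2))"
  proof -
    define z where "z = e\<^sup>2 * A\<^sup>2 / p - 2 * (e * A * B) + e\<^sup>2 * B\<^sup>2 / t"
    have ruw: "r * u * w = e * A * B / (p * t)"
    proof -
      have "r * u * w = e * A * B / ((sqrt p * sqrt p) * (sqrt t * sqrt t))"
        by (simp add: r_def u_def w_def del: real_sqrt_mult_self)
      then show ?thesis using p t by simp
    qed
    have "u\<^sup>2 = A\<^sup>2 / p" "w\<^sup>2 = B\<^sup>2 / t" using p t by (simp_all add: u_def w_def power_divide)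
    then have "r\<^sup>2 * u\<^sup>2 - 2 * r * u * w + r\<^sup>2 * w\<^sup>2 =
        e\<^sup>2 / (p * t) * (A\<^sup>2 / p) - 2 * (e * A * B / (p * t)) + e\<^sup>2 / (p * t) * (B\<^sup>2 / t)"
      unfolding r2 ruw[symmetric] by simp
    also have "\<dots> = z / (p * t)"
      by (simp add: z_def diff_divide_distrib add_divide_distrib mult_ac)
    finally have z: "(r\<^sup>2 * u\<^sup>2 - 2 * r * u * w + r\<^sup>2 * w\<^sup>2) / (1 - r\<^sup>2) = z / d"
      unfolding dr using p t by simp
    have "(x3 - c * x2)\<^sup>2 + t * x2\<^sup>2 = B\<^sup>2 + t * x3\<^sup>2"
      by (simp add: B_def t_def power2_eq_square algebra_simps)
    then have "((x3 - c * x2)\<^sup>2 + t * x2\<^sup>2) / t = (B\<^sup>2 + t * x3\<^sup>2) / t" by (simp only:)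
    then have B: "(x3 - c * x2)\<^sup>2 / t + x2\<^sup>2 = B\<^sup>2 / t + x3\<^sup>2"
      using t by (simp add: add_divide_distrib)
    \<comment> \<open>from \<open>p t = d + e\<^sup>2\<close>; the two terms with \<open>d\<close> are the exponents of the conditional densities\<close>
    have tA: "t * A\<^sup>2 = d * (A\<^sup>2 / p) + e\<^sup>2 * A\<^sup>2 / p" and pB: "p * B\<^sup>2 = d * (B\<^sup>2 / t) + e\<^sup>2 * B\<^sup>2 / t"
      unfolding d(2) left_diff_distrib using p t by simp_all
    have "corr_form a b c x1 x2 x3 = d * x3\<^sup>2 + (t * A\<^sup>2 - 2 * (e * A * B) + p * B\<^sup>2)"
      unfolding d_def corr_det_def corr_form_def p_def t_def e_def A_def B_def
      by (simp add: power2_eq_square algebra_simps)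
    also have "\<dots> = d * (A\<^sup>2 / p + (B\<^sup>2 / t + x3\<^sup>2)) + z"
      unfolding tA pB z_def distrib_left by simp
    finally have "corr_form a b c x1 x2 x3 / d = (d * (A\<^sup>2 / p + (B\<^sup>2 / t + x3\<^sup>2)) + z) / d"
      by (simp only:)
    also have "\<dots> = A\<^sup>2 / p + (B\<^sup>2 / t + x3\<^sup>2) + z / d"
      using d(1) by (simp only: add_divide_distrib[of _ z]) simp
    finally have "corr_form a b c x1 x2 x3 / d = A\<^sup>2 / p + (x3 - c * x2)\<^sup>2 / t + x2\<^sup>2
        + (r\<^sup>2 * u\<^sup>2 - 2 * r * u * w + r\<^sup>2 * w\<^sup>2) / (1 - r\<^sup>2)"
      unfolding B[symmetric] z by (simp only: add.assoc)
    then have E: "- corr_form a b c x1 x2 x3 / (2 * d) = - A\<^sup>2 / (2 * p) + - (x3 - c * x2)\<^sup>2 / (2 * t)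
        + - x2\<^sup>2 / 2 + - (r\<^sup>2 * u\<^sup>2 - 2 * r * u * w + r\<^sup>2 * w\<^sup>2) / (2 * (1 - r\<^sup>2))"
      by (rule exponent_split)
    have "(2 * pi) ^ 3 * d = (2 * pi * p) * (2 * pi * t) * (2 * pi) * (1 - r\<^sup>2)"
      unfolding dr using p t by (simp add: power3_eq_cube)
    then have "sqrt ((2 * pi) ^ 3 * d) = sqrt (2 * pi * p) * sqrt (2 * pi * t) * sqrt (2 * pi) * sqrt (1 - r\<^sup>2)"
      by (simp only: real_sqrt_mult)
    then show ?thesis
      unfolding gaussian_density_corr_matrix[OF D] d_def[symmetric] E exp_add
      by (simp add: f_CN_def f_N_def p_def t_def A_def)
  qed
  ultimately show ?thesis by (rule that)
qed

end

section \<open>The trivariate density\<close>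

lemma f_3D_eq_triple:
  assumes "q \<noteq> 1"
  shows "f_3D q x1 x2 x3 a b c = f_N q x1 * f_N q x2 * f_N q x3 * infsum (triple_term q x1 x2 x3 a b c) UNIV"
  using assms by (simp add: f_3D_def triple_term_def)

text \<open>The transpositions \<open>(1 2)\<close> and \<open>(2 3)\<close> generate all renumberings.  For \<open>|q| < 1\<close> they permute the
  summation indices; for \<open>q = 1\<close> determinant and quadratic form are symmetric.\<close>

lemma f_3D_swap_12:
  assumes "q = 1 \<Longrightarrow> corr_det a b c > 0"
  shows "f_3D q x2 x1 x3 a c b = f_3D q x1 x2 x3 a b c"
proof (cases "q = 1")
  case True
  have "corr_det a c b = corr_det a b c" "corr_form a c b x2 x1 x3 = corr_form a b c x1 x2 x3"
    by (simp_all add: corr_det_def corr_form_def algebra_simps)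
  then show ?thesis using True assms by (simp add: f_3D_def gaussian_density_corr_matrix)
next
  case False
  have "infsum (triple_term q x2 x1 x3 a c b) UNIV = infsum (triple_term q x1 x2 x3 a b c) UNIV"
    by (rule infsum_reindex_bij_witness[where i = "\<lambda>(i, j, k). (k, j, i)" and j = "\<lambda>(i, j, k). (k, j, i)"])
       (auto simp: triple_term_def mult_ac add_ac)
  then show ?thesis using False by (simp add: f_3D_eq_triple mult_ac)
qed

lemma f_3D_swap_23:
  assumes "q = 1 \<Longrightarrow> corr_det a b c > 0"
  shows "f_3D q x1 x3 x2 b a c = f_3D q x1 x2 x3 a b c"
proof (cases "q = 1")
  case True
  have "corr_det b a c = corr_det a b c" "corr_form b a c x1 x3 x2 = corr_form a b c x1 x2 x3"
    by (simp_all add: corr_det_def corr_form_def algebra_simps)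
  then show ?thesis using True assms by (simp add: f_3D_def gaussian_density_corr_matrix)
next
  case False
  have "infsum (triple_term q x1 x3 x2 b a c) UNIV = infsum (triple_term q x1 x2 x3 a b c) UNIV"
    by (rule infsum_reindex_bij_witness[where i = "\<lambda>(i, j, k). (j, i, k)" and j = "\<lambda>(i, j, k). (j, i, k)"])
       (auto simp: triple_term_def mult_ac add_ac)
  then show ?thesis using False by (simp add: f_3D_eq_triple mult_ac)
qed

context
  fixes q x1 x2 x3 a b c :: real
  assumes q: "-1 < q" "q \<le> 1" and x: "x1 \<in> S q" "x2 \<in> S q" "x3 \<in> S q"
    and abc: "\<bar>a\<bar> < 1" "\<bar>b\<bar> < 1" "\<bar>c\<bar> < 1" and D: "q = 1 \<Longrightarrow> corr_det a b c > 0"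
begin

lemma f_3D_expansion_C:
  obtains s where "(\<lambda>n. 1 / qfact q n * qHermite q n x2 * C q n x1 x3 a c b) sums s"
    "f_3D q x1 x2 x3 a b c = f_CN q x3 x1 b * f_N q x1 * f_N q x2 * s"
proof (cases "q = 1")
  case True
  show ?thesis
  proof (rule gaussian_sums_C[OF abc D[OF True], of x2 x1 x3])
    fix s
    assume "(\<lambda>n. 1 / fact n * qHermite 1 n x2 * C 1 n x1 x3 a c b) sums s"
      "gaussian_density (corr_matrix a b c) (vector [x1, x2, x3]) = f_CN 1 x3 x1 b * f_N 1 x1 * f_N 1 x2 * s"
    then show ?thesis by (intro that[of s]) (simp_all add: True qfact_one f_3D_def)
  qed
next
  case False
  then have q': "\<bar>q\<bar> < 1" using q by auto
  have "gam q 0 0 x1 x3 b \<noteq> 0" by (rule gam_nonzero[OF q x(1,3) abc(2)])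
  moreover have "f_CN q x3 x1 b = f_N q x3 * gam q 0 0 x1 x3 b"
    by (simp add: f_CN_eq_gam[OF q x(3,1) abc(2)] gam_commute[of q 0 0 x3])
  ultimately show ?thesis
    by (intro that[OF triple_sums_C[OF q' x abc]]) (simp add: f_3D_eq_triple[OF False])
qed

lemma f_3D_expansion_ASC:
  obtains s where "(\<lambda>n. qpoch_hom q a (b * c) n / (qfact q n * qpoch2 q (b\<^sup>2) (c\<^sup>2) n)
      * ASC q n x1 x3 b * ASC q n x2 x3 c) sums s"
    "f_3D q x1 x2 x3 a b c = f_CN q x1 x3 b * f_CN q x3 x2 c * f_N q x2 * s"
proof (cases "q = 1")
  case True
  show ?thesis
  proof (rule gaussian_sums_ASC[OF abc D[OF True], of x1 x3 x2])
    fix s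
    assume "(\<lambda>n. qpoch_hom 1 a (b * c) n / (fact n * qpoch2 1 (b\<^sup>2) (c\<^sup>2) n)
        * ASC 1 n x1 x3 b * ASC 1 n x2 x3 c) sums s"
      "gaussian_density (corr_matrix a b c) (vector [x1, x2, x3]) =
        f_CN 1 x1 x3 b * f_CN 1 x3 x2 c * f_N 1 x2 * s"
    then show ?thesis by (intro that[of s]) (simp_all add: True qfact_one f_3D_def)
  qed
next
  case False
  then have q': "\<bar>q\<bar> < 1" using q by auto
  have "gam q 0 0 x1 x3 b \<noteq> 0" "gam q 0 0 x2 x3 c \<noteq> 0"
    by (rule gam_nonzero[OF q x(1,3) abc(2)] gam_nonzero[OF q x(2,3) abc(3)])+
  moreover have "f_CN q x1 x3 b = f_N q x1 * gam q 0 0 x1 x3 b" "f_CN q x3 x2 c = f_N q x3 * gam q 0 0 x2 x3 c"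
    by (simp_all add: f_CN_eq_gam[OF q x(1,3) abc(2)] f_CN_eq_gam[OF q x(3,2) abc(3)] gam_commute[of q 0 0 x3])
  ultimately show ?thesis
    by (intro that[OF triple_sums_ASC[OF q' x abc]]) (simp add: f_3D_eq_triple[OF False])
qed

end

theorem proposition1:
  fixes q :: real and \<rho> :: "nat \<Rightarrow> nat \<Rightarrow> real" and x :: "nat \<Rightarrow> real" and a b c :: nat
  assumes "-1 < q" and "q \<le> 1"
    and "\<And>i j. i \<in> {1,2,3} \<Longrightarrow> j \<in> {1,2,3} \<Longrightarrow> \<rho> j i = \<rho> i j"
    and "\<rho> 1 2 \<in> {-1<..<1}" and "\<rho> 1 3 \<in> {-1<..<1}" and "\<rho> 2 3 \<in> {-1<..<1}"
    and "1 + 2 * \<rho> 1 2 * \<rho> 1 3 * \<rho> 2 3 - (\<rho> 1 2)\<^sup>2 - (\<rho> 1 3)\<^sup>2 - (\<rho> 2 3)\<^sup>2 \<ge> 0"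
    and nondegenerate: "q = 1 \<Longrightarrow> det (corr_matrix (\<rho> 1 2) (\<rho> 1 3) (\<rho> 2 3)) \<noteq> 0"
    and "x 1 \<in> S q" and "x 2 \<in> S q" and "x 3 \<in> S q"
    and "[a, b, c] \<in> permutations_of_set {1,2,3}"
  shows "(summable (\<lambda>s. 1 / qfact q s * qHermite q s (x b)
              * C q s (x a) (x c) (\<rho> a b) (\<rho> b c) (\<rho> a c)) \<and>
          f_3D q (x 1) (x 2) (x 3) (\<rho> 1 2) (\<rho> 1 3) (\<rho> 2 3) =
            f_CN q (x c) (x a) (\<rho> a c) * f_N q (x a) * f_N q (x b) *
            (\<Sum>s. 1 / qfact q s * qHermite q s (x b)
              * C q s (x a) (x c) (\<rho> a b) (\<rho> b c) (\<rho> a c)))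
       \<and> (summable (\<lambda>s. qpoch_hom q (\<rho> a b) (\<rho> a c * \<rho> b c) s
                / (qfact q s * qpoch2 q ((\<rho> a c)\<^sup>2) ((\<rho> b c)\<^sup>2) s)
              * ASC q s (x a) (x c) (\<rho> a c) * ASC q s (x b) (x c) (\<rho> b c)) \<and>
          f_3D q (x 1) (x 2) (x 3) (\<rho> 1 2) (\<rho> 1 3) (\<rho> 2 3) =
            f_CN q (x a) (x c) (\<rho> a c) * f_CN q (x c) (x b) (\<rho> b c) * f_N q (x b) *
            (\<Sum>s. qpoch_hom q (\<rho> a b) (\<rho> a c * \<rho> b c) s
                / (qfact q s * qpoch2 q ((\<rho> a c)\<^sup>2) ((\<rho> b c)\<^sup>2) s)
              * ASC q s (x a) (x c) (\<rho> a c) * ASC q s (x b) (x c) (\<rho> b c)))"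
proof -
  note q = assms(1,2) and sym = assms(3)
  define F where "F i j k = f_3D q (x i) (x j) (x k) (\<rho> i j) (\<rho> i k) (\<rho> j k)" for i j k
  define D where "D i j k = corr_det (\<rho> i j) (\<rho> i k) (\<rho> j k)" for i j k
  have sym': "\<rho> 2 1 = \<rho> 1 2" "\<rho> 3 1 = \<rho> 1 3" "\<rho> 3 2 = \<rho> 2 3" by (simp_all add: sym)
  have "D 1 2 3 \<ge> 0" using assms(7) by (simp add: D_def corr_det_def)
  then have D123: "q = 1 \<Longrightarrow> D 1 2 3 > 0" using nondegenerate by (simp add: D_def det_corr_matrix)
  have "set [a, b, c] = {1, 2, 3}" "distinct [a, b, c]"
    by (rule permutations_of_setD[OF assms(12)])+
  then have "a \<in> {1, 2, 3}" "b \<in> {1, 2, 3}" "c \<in> {1, 2, 3}" "distinct [a, b, c]"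
    by auto
  then have cases: "(a, b, c) \<in> {(1,2,3), (1,3,2), (2,1,3), (2,3,1), (3,1,2), (3,2,1)}"
    by auto
  then have Dabc: "D a b c = D 1 2 3"
    by (auto simp: D_def sym' corr_det_def simp del: One_nat_def)
  have F_213: "F 2 1 3 = F 1 2 3" and F_132: "F 1 3 2 = F 1 2 3"
    using f_3D_swap_12[of q "\<rho> 1 2" "\<rho> 1 3" "\<rho> 2 3" "x 2" "x 1" "x 3"]
      f_3D_swap_23[of q "\<rho> 1 2" "\<rho> 1 3" "\<rho> 2 3" "x 1" "x 3" "x 2"] D123
    by (simp_all add: F_def D_def sym' del: One_nat_def)
  have F_231: "F 2 3 1 = F 2 1 3" and F_312: "F 3 1 2 = F 1 3 2"
    using f_3D_swap_23[of q "\<rho> 2 1" "\<rho> 2 3" "\<rho> 1 3" "x 2" "x 3" "x 1"]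
      f_3D_swap_12[of q "\<rho> 1 3" "\<rho> 1 2" "\<rho> 3 2" "x 3" "x 1" "x 2"] D123
    by (simp_all add: F_def D_def sym' corr_det_def algebra_simps del: One_nat_def)
  have F_321: "F 3 2 1 = F 2 3 1"
    using f_3D_swap_12[of q "\<rho> 2 3" "\<rho> 2 1" "\<rho> 3 1" "x 3" "x 2" "x 1"] D123
    by (simp add: F_def D_def sym' corr_det_def algebra_simps del: One_nat_def)
  have Fabc: "F 1 2 3 = F a b c"
    using cases F_213 F_132 F_231 F_312 F_321 by auto
  have \<rho>: "\<bar>\<rho> a b\<bar> < 1" "\<bar>\<rho> a c\<bar> < 1" "\<bar>\<rho> b c\<bar> < 1"
    using cases assms(4,5,6) by (auto simp: sym' simp del: One_nat_def)
  have x: "x a \<in> S q" "x b \<in> S q" "x c \<in> S q"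
    using cases assms(9,10,11) by auto
  have D: "q = 1 \<Longrightarrow> corr_det (\<rho> a b) (\<rho> a c) (\<rho> b c) > 0"
    using D123 Dabc by (simp add: D_def)
  obtain s where s: "(\<lambda>n. 1 / qfact q n * qHermite q n (x b) * C q n (x a) (x c) (\<rho> a b) (\<rho> b c) (\<rho> a c)) sums s"
    "F a b c = f_CN q (x c) (x a) (\<rho> a c) * f_N q (x a) * f_N q (x b) * s"
    unfolding F_def by (rule f_3D_expansion_C[OF q x \<rho> D])
  obtain t where t: "(\<lambda>n. qpoch_hom q (\<rho> a b) (\<rho> a c * \<rho> b c) n / (qfact q n * qpoch2 q ((\<rho> a c)\<^sup>2) ((\<rho> b c)\<^sup>2) n)
      * ASC q n (x a) (x c) (\<rho> a c) * ASC q n (x b) (x c) (\<rho> b c)) sums t"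
    "F a b c = f_CN q (x a) (x c) (\<rho> a c) * f_CN q (x c) (x b) (\<rho> b c) * f_N q (x b) * t"
    unfolding F_def by (rule f_3D_expansion_ASC[OF q x \<rho> D])
  have f: "f_3D q (x 1) (x 2) (x 3) (\<rho> 1 2) (\<rho> 1 3) (\<rho> 2 3) = F a b c"
    using Fabc by (simp add: F_def)
  show ?thesis
    unfolding f
    by (intro conjI sums_summable[OF s(1)] sums_summable[OF t(1)]
        s(2)[unfolded sums_unique[OF s(1)]] t(2)[unfolded sums_unique[OF t(1)]])
qed

end
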